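(* Let $I=(0,1)$ and $\Omega=(0,1)$, and let $V=H^1(\Omega)$. Let $\phi\in H_0^1(I)\setminus\{0\}$ be given with $\phi\ge 0$, extended by zero to $\mathbb{R}$. For $n\in\mathbb{N}$, $n\ge 1$, define $\psi_n(x):=\cos(n\pi x)$ for $x\in\Omega$ and $\phi_n(t):=n(n+1)\,\phi\big(n(n+1)t-n\big)$ for $t\in I$. Define $$u(x,t):=\sum_{n=1}^\infty n^{-3}\,\phi_n(t)\,\psi_n(x),\qquad x\in\Omega,\ t\in I.$$ Then $u$ belongs to $W=\{u\in L^2(I;V):\ \partial_t u\in L^2(I;V^* )\}$. However, the time derivative $\partial_t u^+$ of its positive part does not belong to $L^1(I;V^* )$.
   Context: All functions are real-valued. $V=H^1(\Omega)$ is equipped with the inner product $(u,v)_V=\int_\Omega \nabla u\cdot\nabla v+uv\,dx$, $H=L^2(\Omega)$ with the standard $L^2(\Omega)$ inner product, and $V\subset H=H^*\subset V^*$ is the associated evolution (Gelfand) triple, i.e. $h\in H$ is identified with the functional $v\mapsto (h,v)_H$ on $V$. The spaces $L^p(I;X)$ are Bochner spaces. $\partial_t$ denotes the weak (distributional) derivative with respect to $t\in I$, with values in $V^*$; the statement $\partial_t u^+\notin L^1(I;V^* )$ means that there is no function in $L^1(I;V^* )$ which is the weak time derivative of $u^+$ on $I$. The positive part is $u^+(x,t)=\max(u(x,t),0)$. *)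

theory Defs
  imports "HOL-Analysis.Analysis"
begin

text \<open>
  In the theorem both the time interval and the spatial domain are \<open>(0,1)\<close>; the measure below serves
  for both. The types \<open>l2\<close> and \<open>h1\<close> are the Hilbert spaces \<open>H = L^2(0,1)\<close> and \<open>V = H^1(0,1)\<close>, and
  \<open>h1 \<Rightarrow>\<^sub>L real\<close> is \<open>V^*\<close> with the operator norm. All of them are shown to be complete and second
  countable, so that the Bochner integral of the library applies and Borel measurability coincides
  with strong measurability.
\<close>

abbreviation leb01 :: "real measure" where
  "leb01 \<equiv> lebesgue_on {0<..<1}"

section \<open>Bochner spaces, test functions and weak derivatives on the unit interval\<close>

text \<open>For exponents \<open>p \<ge> 1\<close>; elements are functions, not equivalence classes, and their values outside
  \<open>(0,1)\<close> are irrelevant.\<close>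

definition bochner_Lp :: "nat \<Rightarrow> (real \<Rightarrow> 'b::{banach, second_countable_topology}) set" where
  "bochner_Lp p = {F. F \<in> borel_measurable leb01 \<and> integrable leb01 (\<lambda>t. norm (F t) ^ p)}"

definition loc_integrable :: "(real \<Rightarrow> 'b::{banach, second_countable_topology}) \<Rightarrow> bool" where
  "loc_integrable F \<longleftrightarrow> (\<forall>K. compact K \<and> K \<subseteq> {0<..<1} \<longrightarrow> set_integrable lebesgue K F)"

definition test_functions :: "(real \<Rightarrow> real) set" where
  "test_functions =
     {\<eta>. (\<forall>k. (deriv ^^ k) \<eta> differentiable_on UNIV) \<and>
         compact (closure {t. \<eta> t \<noteq> 0}) \<and> closure {t. \<eta> t \<noteq> 0} \<subseteq> {0<..<1}}"

definition has_weak_deriv ::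
  "(real \<Rightarrow> 'b::{banach, second_countable_topology}) \<Rightarrow> (real \<Rightarrow> 'b) \<Rightarrow> bool" where
  "has_weak_deriv F G \<longleftrightarrow> loc_integrable F \<and> loc_integrable G \<and>
     (\<forall>\<eta>\<in>test_functions.
        (LINT t|leb01. deriv \<eta> t *\<^sub>R F t) = - (LINT t|leb01. \<eta> t *\<^sub>R G t))"

section \<open>Preliminaries on separability\<close>

lemma second_countable_of_dense:
  fixes X :: "'a::metric_space set"
  assumes "countable X" and dense: "\<And>x e. e > 0 \<Longrightarrow> \<exists>d\<in>X. dist d x < e"
  shows "\<exists>B::'a set set. countable B \<and> open = generate_topology B"
proof -
  let ?B = "(\<lambda>(x, n::nat). ball x (1 / Suc n)) ` (X \<times> UNIV)"
  have "topological_basis ?B"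
  proof (rule topological_basisI)
    fix S assume "S \<in> ?B" then show "open S" by auto
  next
    fix S and x :: 'a assume S: "open S" "x \<in> S"
    then obtain e where e: "e > 0" "ball x e \<subseteq> S"
      using open_contains_ball by blast
    obtain n where n: "1 / Suc n < e / 2"
      using e(1) by (metis half_gt_zero nat_approx_posE)
    obtain d where d: "d \<in> X" "dist d x < 1 / Suc n"
      using dense[of "1 / Suc n" x] by auto
    have "ball d (1 / Suc n) \<subseteq> ball x e"
    proof
      fix y assume "y \<in> ball d (1 / Suc n)"
      then have "dist d y < 1 / Suc n" by simp
      with d(2) n have "dist x y < e"
        using dist_triangle[of x y d] by (simp add: dist_commute)
      then show "y \<in> ball x e" by simp
    qed
    with d e show "\<exists>B'\<in>?B. x \<in> B' \<and> B' \<subseteq> S"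
      by (intro bexI[of _ "ball d (1 / Suc n)"]) auto
  qed
  then have "open = generate_topology ?B"
    by (rule topological_basis_imp_subbasis)
  moreover have "countable ?B" using assms(1) by auto
  ultimately show ?thesis by blast
qed

lemma second_countable_of_isometry:
  fixes f :: "'a::metric_space \<Rightarrow> 'b::{metric_space, second_countable_topology}"
  assumes iso: "\<And>x y. dist (f x) (f y) = dist x y"
  shows "\<exists>B::'a set set. countable B \<and> open = generate_topology B"
proof -
  obtain B :: "'b set set" where B: "countable B" "topological_basis B"
    using ex_countable_basis by blast
  let ?X = "(\<lambda>b. SOME x. f x \<in> b) ` B"
  show ?thesis
  proof (rule second_countable_of_dense[of ?X])
    show "countable ?X" using B by auto
    fix x :: 'a and e :: real assume "e > 0"
    then obtain b where b: "b \<in> B" "f x \<in> b" "b \<subseteq> ball (f x) e"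
      using topological_basisE[OF B(2), of "ball (f x) e" "f x"] by auto
    have "f (SOME x. f x \<in> b) \<in> b" by (rule someI) (rule b(2))
    with b(3) have "dist (f x) (f (SOME x. f x \<in> b)) < e" by auto
    then show "\<exists>d\<in>?X. dist d x < e"
      using b(1) by (auto simp: iso dist_commute)
  qed
qed

lemma countable_dense_subspace:
  fixes g :: "nat \<Rightarrow> 'a::real_normed_vector"
  shows "\<exists>X. countable X \<and> range g \<subseteq> X \<and> subspace (closure X)"
proof -
  define h where "h l = sum_list (map (\<lambda>(q::rat, n). (of_rat q :: real) *\<^sub>R g n) l)" for l
  let ?X = "range h"
  have cnt: "countable ?X" by simp
  have "g n = h [(1, n)]" for n by (simp add: h_def)
  then have gX: "range g \<subseteq> ?X" by auto
  have add: "x + y \<in> ?X" if "x \<in> ?X" "y \<in> ?X" for x y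
  proof -
    from that obtain k l where "x = h k" "y = h l" by auto
    then have "x + y = h (k @ l)" by (simp add: h_def)
    then show ?thesis by simp
  qed
  have scale: "(of_rat q :: real) *\<^sub>R x \<in> ?X" if "x \<in> ?X" for q x
  proof -
    from that obtain l where l: "x = h l" by auto
    have "(of_rat q :: real) *\<^sub>R h l = h (map (\<lambda>(r, n). (q * r, n)) l)"
      by (induction l) (auto simp: h_def of_rat_mult scaleR_add_right)
    with l show ?thesis by auto
  qed
  have "subspace (closure ?X)"
    unfolding subspace_def
  proof (intro conjI ballI allI)
    have "h [] = 0" by (simp add: h_def)
    then show "0 \<in> closure ?X" by (metis closure_subset rangeI subsetD)
  next
    fix x y assume "x \<in> closure ?X" "y \<in> closure ?X"
    then obtain a b where "\<And>n::nat. a n \<in> ?X" "a \<longlonglongrightarrow> x" "\<And>n::nat. b n \<in> ?X" "b \<longlonglongrightarrow> y"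
      unfolding closure_sequential by blast
    then show "x + y \<in> closure ?X"
      unfolding closure_sequential
      by (intro exI[of _ "\<lambda>n. a n + b n"]) (auto intro!: add tendsto_add)
  next
    fix c :: real and x assume "x \<in> closure ?X"
    then obtain a where a: "\<And>n::nat. a n \<in> ?X" "a \<longlonglongrightarrow> x"
      unfolding closure_sequential by blast
    have "c \<in> closure \<rat>" by (simp add: Rats_closure_real)
    then obtain q where q: "\<And>n::nat. q n \<in> \<rat>" "q \<longlonglongrightarrow> c"
      unfolding closure_sequential by blast
    have "q n *\<^sub>R a n \<in> ?X" for n
      using q(1)[of n] scale[OF a(1)[of n]] by (auto simp: Rats_def)
    with a q show "c *\<^sub>R x \<in> closure ?X"
      unfolding closure_sequential
      by (intro exI[of _ "\<lambda>n. q n *\<^sub>R a n"]) (auto intro!: tendsto_scaleR)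
  qed
  with cnt gX show ?thesis by blast
qed

section \<open>Duals of separable Hilbert spaces are separable\<close>

lemma riesz_representation:
  fixes f :: "'a::{real_inner, complete_space} \<Rightarrow>\<^sub>L real"
  shows "\<exists>z. \<forall>x. blinfun_apply f x = z \<bullet> x"
proof -
  define J where "J v = (norm v)\<^sup>2 / 2 - f v" for v
  have J_bdd: "J v \<ge> - (norm f)\<^sup>2 / 2" for v
  proof -
    have "f v \<le> norm f * norm v"
      using norm_blinfun[of f v] by simp
    moreover have "0 \<le> (norm v - norm f)\<^sup>2" by simp
    ultimately show ?thesis by (simp add: J_def power2_eq_square algebra_simps)
  qed
  define m where "m = (INF v. J v)"
  have bdd: "bdd_below (range J)" using J_bdd by (intro bdd_belowI) auto
  have m_le: "m \<le> J v" for v unfolding m_def by (rule cINF_lower[OF bdd]) simp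
  have "\<exists>v. J v < m + 1 / real (Suc n)" for n
    using cINF_less_iff[OF _ bdd, of "m + 1 / real (Suc n)"] by (simp add: m_def)
  then obtain s where s: "\<And>n. J (s n) < m + 1 / real (Suc n)" by metis
  have par: "(norm (v - w))\<^sup>2 / 4 = J v + J w - 2 * J ((1/2) *\<^sub>R (v + w))" for v w
    by (simp add: J_def power2_norm_eq_inner inner_diff_left inner_diff_right inner_add_left
        inner_add_right inner_commute blinfun.add_right blinfun.scaleR_right field_simps)
  have close: "(norm (s i - s j))\<^sup>2 < 4 * (1 / real (Suc i) + 1 / real (Suc j))" for i j
  proof -
    have "a < 4 * (p + q)" if "a / 4 = b + c - 2 * d" "b < m + p" "c < m + q" "m \<le> d"
      for a b c d p q :: real
      using that by argo
    then show ?thesis using par s m_le by blast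
  qed
  have "Cauchy s"
  proof (rule metric_CauchyI)
    fix e :: real assume e: "e > 0"
    obtain N where N: "1 / real (Suc N) < e\<^sup>2 / 8"
      using e by (metis nat_approx_posE zero_less_divide_iff zero_less_numeral zero_less_power)
    have "dist (s i) (s j) < e" if "i \<ge> N" "j \<ge> N" for i j
    proof -
      have "1 / real (Suc i) \<le> 1 / real (Suc N)" "1 / real (Suc j) \<le> 1 / real (Suc N)"
        using that by (auto intro!: divide_left_mono)
      moreover have "a < d" if "p \<le> r" "q \<le> r" "a < 4 * (p + q)" "r < d / 8" for a d p q r :: real
        using that by argo
      ultimately have "(norm (s i - s j))\<^sup>2 < e\<^sup>2" using close[of i j] N by blast
      then show ?thesis using e by (simp add: dist_norm power_less_imp_less_base)
    qed
    then show "\<exists>N. \<forall>i\<ge>N. \<forall>j\<ge>N. dist (s i) (s j) < e" by blast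
  qed
  then obtain z where z: "s \<longlonglongrightarrow> z" using Cauchy_convergent convergent_def by blast
  have "(\<lambda>n. J (s n)) \<longlonglongrightarrow> J z"
    unfolding J_def by (intro tendsto_intros z) auto
  moreover have "(\<lambda>n. J (s n)) \<longlonglongrightarrow> m"
  proof (rule tendsto_sandwich[of "\<lambda>_. m" _ _ "\<lambda>n. m + 1 / real (Suc n)"])
    show "(\<lambda>n. m + 1 / real (Suc n)) \<longlonglongrightarrow> m"
      using tendsto_add[OF tendsto_const LIMSEQ_Suc[OF lim_1_over_n], of m] by simp
  qed (use m_le s less_imp_le in \<open>auto intro!: always_eventually\<close>)
  ultimately have Jz: "J z = m" using LIMSEQ_unique by blast
  have "f x = z \<bullet> x" for x
  proof (rule ccontr)
    assume "f x \<noteq> z \<bullet> x"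
    define d where "d = f x - z \<bullet> x"
    define N where "N = (norm x)\<^sup>2"
    have d0: "d \<noteq> 0" using \<open>f x \<noteq> z \<bullet> x\<close> by (simp add: d_def)
    have ineq: "0 \<le> t\<^sup>2 * N / 2 - t * d" for t
    proof -
      have "(norm (z + t *\<^sub>R x))\<^sup>2 = (norm z)\<^sup>2 + 2 * t * (z \<bullet> x) + t\<^sup>2 * N"
        unfolding N_def power2_norm_eq_inner
        by (simp only: inner_add_left inner_add_right inner_scaleR_left inner_scaleR_right
            inner_commute[of x z] power2_eq_square) (simp add: algebra_simps)
      then have "J (z + t *\<^sub>R x) = J z + t\<^sup>2 * N / 2 - t * d"
        by (simp add: J_def d_def blinfun.add_right blinfun.scaleR_right field_simps)
      with m_le[of "z + t *\<^sub>R x"] Jz show ?thesis by simp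
    qed
    have N0: "N \<ge> 0" by (simp add: N_def)
    define e where "e = d / (N + 1)"
    have e: "d = e * (N + 1)" using N0 by (simp add: e_def)
    have "0 \<le> e\<^sup>2 * N / 2 - e * d" by (rule ineq)
    also have "\<dots> = e\<^sup>2 * (N / 2 - (N + 1))"
      by (simp add: e power2_eq_square algebra_simps)
    also have "\<dots> < 0"
      using d0 e N0 by (intro mult_pos_neg) auto
    finally show False by simp
  qed
  then show ?thesis by blast
qed

instance blinfun ::
  ("{real_inner, complete_space, second_countable_topology}", euclidean_space)
  second_countable_topology
proof
  obtain D :: "'a set" where D: "countable D" "\<And>U. open U \<Longrightarrow> U \<noteq> {} \<Longrightarrow> \<exists>y\<in>D. y \<in> U"
    by (rule countable_dense_setE) blast
  define mk :: "('b \<Rightarrow> 'a) \<Rightarrow> 'a \<Rightarrow>\<^sub>L 'b"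
    where "mk z = (\<Sum>b\<in>Basis. blinfun_scaleR_left b o\<^sub>L blinfun_inner_right (z b))" for z
  have mk_apply: "mk z x = (\<Sum>b\<in>Basis. (z b \<bullet> x) *\<^sub>R b)" for z x
    by (simp add: mk_def blinfun.sum_left)
  have bound: "norm (f - mk w) \<le> (\<Sum>b\<in>Basis. norm (z b - w b))" if "f = mk z" for f z w
  proof (rule norm_blinfun_bound)
    show "0 \<le> (\<Sum>b\<in>Basis. norm (z b - w b))" by (simp add: sum_nonneg)
    fix x
    have "(f - mk w) x = (\<Sum>b\<in>Basis. ((z b - w b) \<bullet> x) *\<^sub>R b)"
      using that by (simp add: mk_apply blinfun.diff_left inner_diff_left scaleR_diff_left
          sum_subtractf)
    also have "norm \<dots> \<le> (\<Sum>b\<in>Basis. \<bar>(z b - w b) \<bullet> x\<bar>)"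
      by (rule order_trans[OF norm_sum]) simp
    also have "\<dots> \<le> (\<Sum>b\<in>Basis. norm (z b - w b) * norm x)"
      by (intro sum_mono Cauchy_Schwarz_ineq2)
    finally show "norm ((f - mk w) x) \<le> (\<Sum>b\<in>Basis. norm (z b - w b)) * norm x"
      by (simp add: sum_distrib_right)
  qed
  let ?X = "mk ` (PiE Basis (\<lambda>_. D))"
  show "\<exists>B::('a \<Rightarrow>\<^sub>L 'b) set set. countable B \<and> open = generate_topology B"
  proof (rule second_countable_of_dense[of ?X])
    show "countable ?X" using D(1) by (intro countable_image countable_PiE) auto
    fix f :: "'a \<Rightarrow>\<^sub>L 'b" and e :: real assume e: "e > 0"
    have "\<exists>z. \<forall>x. f x \<bullet> b = z \<bullet> x" for b
      using riesz_representation[of "blinfun_inner_left b o\<^sub>L f"] by (simp add: inner_commute)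
    then obtain z where z: "\<And>b x. f x \<bullet> b = z b \<bullet> x" by metis
    have f: "f = mk z"
      by (rule blinfun_eqI) (simp add: mk_apply z[symmetric] euclidean_representation)
    define d where "d = e / (2 * real DIM('b))"
    have d: "d > 0" using e by (simp add: d_def)
    have "\<exists>y\<in>D. dist (z b) y < d" for b
      using D(2)[of "ball (z b) d"] d by auto
    then obtain y where y: "\<And>b. y b \<in> D" "\<And>b. dist (z b) (y b) < d" by metis
    let ?w = "restrict y Basis"
    have "norm (f - mk ?w) \<le> (\<Sum>b\<in>Basis. norm (z b - ?w b))" by (rule bound[OF f])
    also have "\<dots> \<le> (\<Sum>b\<in>(Basis::'b set). d)"
      using y(2) by (intro sum_mono) (auto simp: dist_norm intro: less_imp_le)
    also have "\<dots> = e / 2" by (simp add: d_def)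
    also have "\<dots> < e" using e by simp
    finally have "dist (mk ?w) f < e" by (simp add: dist_norm norm_minus_commute)
    moreover have "?w \<in> PiE Basis (\<lambda>_. D)" using y(1) by auto
    ultimately show "\<exists>d\<in>?X. dist d f < e" by blast
  qed
qed

section \<open>The Hilbert space of square-integrable functions\<close>

abbreviation L2_fun :: "(real \<Rightarrow> real) set" where
  "L2_fun \<equiv> bochner_Lp 2"

lemma L2_fun_iff: "f \<in> L2_fun \<longleftrightarrow> f \<in> borel_measurable leb01 \<and> integrable leb01 (\<lambda>x. (f x)\<^sup>2)"
  by (simp add: bochner_Lp_def)

lemma L2_fun_measurable [measurable_dest]: "f \<in> L2_fun \<Longrightarrow> f \<in> borel_measurable leb01"
  by (simp add: L2_fun_iff)

lemma finite_measure_leb01: "finite_measure leb01"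
  by (rule finite_measure_lebesgue_on) simp

lemma L2_fun_dominated:
  assumes "f \<in> borel_measurable leb01" "g \<in> L2_fun" "AE x in leb01. \<bar>f x\<bar> \<le> \<bar>g x\<bar>"
  shows "f \<in> L2_fun"
  unfolding L2_fun_iff
proof (intro conjI assms(1))
  show "integrable leb01 (\<lambda>x. (f x)\<^sup>2)"
  proof (rule Bochner_Integration.integrable_bound)
    show "integrable leb01 (\<lambda>x. (g x)\<^sup>2)" using assms(2) by (simp add: L2_fun_iff)
    show "AE x in leb01. norm ((f x)\<^sup>2) \<le> norm ((g x)\<^sup>2)"
      using assms(3) by eventually_elim (simp add: abs_le_square_iff)
  qed (use assms(1) in measurable)
qed

lemma L2_fun_const: "(\<lambda>_. c) \<in> L2_fun"
  using finite_measure.integrable_const[OF finite_measure_leb01] by (simp add: L2_fun_iff)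

lemma L2_fun_bounded:
  assumes "f \<in> borel_measurable leb01" "AE x in leb01. \<bar>f x\<bar> \<le> B"
  shows "f \<in> L2_fun"
  by (rule L2_fun_dominated[OF assms(1) L2_fun_const[of B]]) (use assms(2) in eventually_elim, simp)

lemma L2_fun_scale: "f \<in> L2_fun \<Longrightarrow> (\<lambda>x. c * f x) \<in> L2_fun"
  by (auto simp: L2_fun_iff power_mult_distrib)

lemma L2_fun_mult_integrable:
  assumes "f \<in> L2_fun" "g \<in> L2_fun"
  shows "integrable leb01 (\<lambda>x. f x * g x)"
proof (rule Bochner_Integration.integrable_bound)
  show "integrable leb01 (\<lambda>x. (f x)\<^sup>2 + (g x)\<^sup>2)"
    using assms by (auto simp: L2_fun_iff)
  show "(\<lambda>x. f x * g x) \<in> borel_measurable leb01" using assms by measurable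
  have "\<bar>a * b\<bar> \<le> a\<^sup>2 + b\<^sup>2" for a b :: real
  proof -
    have "0 \<le> (\<bar>a\<bar> - \<bar>b\<bar>)\<^sup>2" by simp
    then have "2 * (\<bar>a\<bar> * \<bar>b\<bar>) \<le> a\<^sup>2 + b\<^sup>2" by (simp add: power2_diff)
    moreover have "0 \<le> \<bar>a\<bar> * \<bar>b\<bar>" by simp
    ultimately have "\<bar>a\<bar> * \<bar>b\<bar> \<le> a\<^sup>2 + b\<^sup>2" by linarith
    then show ?thesis by (simp only: abs_mult)
  qed
  then show "AE x in leb01. norm (f x * g x) \<le> norm ((f x)\<^sup>2 + (g x)\<^sup>2)"
    by (intro AE_I2) simp
qed

lemma L2_fun_add:
  assumes "f \<in> L2_fun" "g \<in> L2_fun"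
  shows "(\<lambda>x. f x + g x) \<in> L2_fun"
proof -
  have "integrable leb01 (\<lambda>x. (f x)\<^sup>2 + (g x)\<^sup>2 + 2 * (f x * g x))"
    using assms L2_fun_mult_integrable[OF assms]
    by (intro Bochner_Integration.integrable_add integrable_mult_right) (auto simp: L2_fun_iff)
  moreover have "(\<lambda>x. f x + g x) \<in> borel_measurable leb01" using assms by measurable
  ultimately show ?thesis by (simp add: L2_fun_iff power2_sum mult.assoc)
qed

lemma L2_fun_diff: "f \<in> L2_fun \<Longrightarrow> g \<in> L2_fun \<Longrightarrow> (\<lambda>x. f x - g x) \<in> L2_fun"
  using L2_fun_add[of f "\<lambda>x. - 1 * g x"] L2_fun_scale[of g "-1"] by simp

lemma L2_fun_integrable: "f \<in> L2_fun \<Longrightarrow> integrable leb01 f"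
  using L2_fun_mult_integrable[OF _ L2_fun_const[of 1]] by simp

definition l2_rel :: "(real \<Rightarrow> real) \<Rightarrow> (real \<Rightarrow> real) \<Rightarrow> bool" where
  "l2_rel f g \<longleftrightarrow> f \<in> L2_fun \<and> g \<in> L2_fun \<and> (AE x in leb01. f x = g x)"

quotient_type l2 = "real \<Rightarrow> real" / partial: l2_rel
  morphisms rep_l2 abs_l2
proof (rule part_equivpI)
  show "\<exists>f. l2_rel f f" using L2_fun_const[of 0] by (auto simp: l2_rel_def)
  show "symp l2_rel" by (rule sympI) (auto simp: l2_rel_def elim: AE_mp)
  show "transp l2_rel" by (rule transpI) (auto simp: l2_rel_def elim: AE_mp)
qed

instantiation l2 :: real_inner
begin

lift_definition zero_l2 :: l2 is "\<lambda>_. 0"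
  by (simp add: l2_rel_def L2_fun_const)

lift_definition plus_l2 :: "l2 \<Rightarrow> l2 \<Rightarrow> l2" is "\<lambda>f g x. f x + g x"
  by (auto simp: l2_rel_def L2_fun_add)

lift_definition minus_l2 :: "l2 \<Rightarrow> l2 \<Rightarrow> l2" is "\<lambda>f g x. f x - g x"
  by (auto simp: l2_rel_def L2_fun_diff)

lift_definition uminus_l2 :: "l2 \<Rightarrow> l2" is "\<lambda>f x. - f x"
  using L2_fun_scale[of _ "-1"] by (auto simp: l2_rel_def)

lift_definition scaleR_l2 :: "real \<Rightarrow> l2 \<Rightarrow> l2" is "\<lambda>c f x. c * f x"
  by (auto simp: l2_rel_def L2_fun_scale)

lift_definition inner_l2 :: "l2 \<Rightarrow> l2 \<Rightarrow> real" is "\<lambda>f g. LINT x|leb01. f x * g x"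
proof -
  fix f f' g g' assume *: "l2_rel f f'" "l2_rel g g'"
  then have "AE x in leb01. f x * g x = f' x * g' x" by (auto simp: l2_rel_def)
  moreover have "(\<lambda>x. f x * g x) \<in> borel_measurable leb01" "(\<lambda>x. f' x * g' x) \<in> borel_measurable leb01"
    using * by (auto simp: l2_rel_def dest!: L2_fun_measurable)
  ultimately show "(LINT x|leb01. f x * g x) = (LINT x|leb01. f' x * g' x)"
    by (intro integral_cong_AE) auto
qed

definition norm_l2 :: "l2 \<Rightarrow> real" where "norm_l2 v = sqrt (inner v v)"

definition sgn_l2 :: "l2 \<Rightarrow> l2" where "sgn_l2 v = inverse (norm v) *\<^sub>R v"

definition dist_l2 :: "l2 \<Rightarrow> l2 \<Rightarrow> real" where "dist_l2 v w = norm (v - w)"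

definition uniformity_l2 :: "(l2 \<times> l2) filter" where
  "uniformity_l2 = (INF e\<in>{0<..}. principal {(v, w). dist v w < e})"

definition open_l2 :: "l2 set \<Rightarrow> bool" where
  "open_l2 S \<longleftrightarrow> (\<forall>v\<in>S. \<forall>\<^sub>F (v', w) in uniformity. v' = v \<longrightarrow> w \<in> S)"

instance
proof
  fix a b c :: l2 and r s :: real
  show "a + b + c = a + (b + c)"
    by transfer (auto simp: l2_rel_def add.assoc intro!: L2_fun_add)
  show "a + b = b + a" by transfer (auto simp: l2_rel_def add.commute intro!: L2_fun_add)
  show "0 + a = a" by transfer (auto simp: l2_rel_def)
  show "- a + a = 0"
    by transfer (use L2_fun_const[of 0] in \<open>auto simp: l2_rel_def\<close>)
  show "a - b = a + - b"
    by transfer (auto simp: l2_rel_def intro!: L2_fun_diff)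
  show "r *\<^sub>R (a + b) = r *\<^sub>R a + r *\<^sub>R b"
    by transfer (auto simp: l2_rel_def distrib_left intro!: L2_fun_add L2_fun_scale)
  show "(r + s) *\<^sub>R a = r *\<^sub>R a + s *\<^sub>R a"
    by transfer (auto simp: l2_rel_def distrib_right intro!: L2_fun_add L2_fun_scale)
  show "r *\<^sub>R s *\<^sub>R a = (r * s) *\<^sub>R a"
    by transfer (auto simp: l2_rel_def mult.assoc intro!: L2_fun_scale)
  show "1 *\<^sub>R a = a" by transfer (auto simp: l2_rel_def)
  show "sgn a = inverse (norm a) *\<^sub>R a" by (rule sgn_l2_def)
  show "dist a b = norm (a - b)" by (rule dist_l2_def)
  show "(uniformity :: (l2 \<times> l2) filter) = (INF e\<in>{0<..}. principal {(v, w). dist v w < e})"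
    by (rule uniformity_l2_def)
  show "open S \<longleftrightarrow> (\<forall>v\<in>S. \<forall>\<^sub>F (v', w) in uniformity. v' = v \<longrightarrow> w \<in> S)" for S :: "l2 set"
    by (rule open_l2_def)
  show "inner a b = inner b a" by transfer (simp add: mult.commute)
  show "inner (a + b) c = inner a c + inner b c"
    by transfer (auto simp: l2_rel_def distrib_right L2_fun_mult_integrable)
  show "inner (r *\<^sub>R a) b = r * inner a b"
    by transfer (auto simp: mult.assoc)
  show "0 \<le> inner a a" by transfer simp
  show "inner a a = 0 \<longleftrightarrow> a = 0"
  proof (transfer)
    fix a assume a: "l2_rel a a"
    then have int: "integrable leb01 (\<lambda>x. a x * a x)"
      by (auto simp: l2_rel_def intro: L2_fun_mult_integrable)
    have "(LINT x|leb01. a x * a x) = 0 \<longleftrightarrow> (AE x in leb01. a x * a x = 0)"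
      by (rule integral_nonneg_eq_0_iff_AE[OF int]) simp
    also have "\<dots> \<longleftrightarrow> l2_rel a (\<lambda>_. 0)"
      using a by (simp add: l2_rel_def L2_fun_const)
    finally show "(LINT x|leb01. a x * a x) = 0 \<longleftrightarrow> l2_rel a (\<lambda>_. 0)" .
  qed
  show "norm a = sqrt (inner a a)" by (rule norm_l2_def)
qed

end

lemma rep_l2_in: "rep_l2 v \<in> L2_fun"
  using Quotient3_rep_reflp[OF Quotient3_l2, of v] by (simp add: l2_rel_def)

lemma abs_rep_l2 [simp]: "abs_l2 (rep_l2 v) = v"
  by (rule Quotient3_abs_rep[OF Quotient3_l2])

lemma abs_l2_eq_iff:
  "f \<in> L2_fun \<Longrightarrow> g \<in> L2_fun \<Longrightarrow> abs_l2 f = abs_l2 g \<longleftrightarrow> (AE x in leb01. f x = g x)"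
  using Quotient3_rel[OF Quotient3_l2, of f g] by (auto simp: l2_rel_def)

lemma rep_abs_l2: "f \<in> L2_fun \<Longrightarrow> AE x in leb01. rep_l2 (abs_l2 f) x = f x"
  using abs_l2_eq_iff[OF rep_l2_in] abs_rep_l2 by blast

lemma abs_l2_add: "f \<in> L2_fun \<Longrightarrow> g \<in> L2_fun \<Longrightarrow> abs_l2 (\<lambda>x. f x + g x) = abs_l2 f + abs_l2 g"
  by (simp add: plus_l2.abs_eq l2_rel_def)

lemma abs_l2_diff: "f \<in> L2_fun \<Longrightarrow> g \<in> L2_fun \<Longrightarrow> abs_l2 (\<lambda>x. f x - g x) = abs_l2 f - abs_l2 g"
  by (simp add: minus_l2.abs_eq l2_rel_def)

lemma abs_l2_scale: "f \<in> L2_fun \<Longrightarrow> abs_l2 (\<lambda>x. c * f x) = c *\<^sub>R abs_l2 f"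
  by (simp add: scaleR_l2.abs_eq l2_rel_def)

lemma inner_abs_l2:
  "f \<in> L2_fun \<Longrightarrow> g \<in> L2_fun \<Longrightarrow> inner (abs_l2 f) (abs_l2 g) = (LINT x|leb01. f x * g x)"
  by (simp add: inner_l2.abs_eq l2_rel_def)

lemma inner_l2_rep: "inner v w = (LINT x|leb01. rep_l2 v x * rep_l2 w x)"
  using inner_abs_l2[OF rep_l2_in rep_l2_in, of v w] by simp

lemma norm_abs_l2_sq: "f \<in> L2_fun \<Longrightarrow> (norm (abs_l2 f))\<^sup>2 = (LINT x|leb01. (f x)\<^sup>2)"
  unfolding power2_norm_eq_inner by (subst inner_abs_l2) (simp_all add: power2_eq_square)

lemma L2_fun_L1_bound:
  assumes "f \<in> L2_fun"
  shows "(LINT x|leb01. \<bar>f x\<bar>) \<le> norm (abs_l2 f)"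
proof -
  have f: "(\<lambda>x. \<bar>f x\<bar>) \<in> L2_fun"
    using assms by (auto simp: L2_fun_iff)
  have "(LINT x|leb01. \<bar>f x\<bar>) = inner (abs_l2 (\<lambda>x. \<bar>f x\<bar>)) (abs_l2 (\<lambda>_. 1))"
    using f L2_fun_const[of 1] by (simp add: inner_abs_l2)
  also have "\<dots> \<le> norm (abs_l2 (\<lambda>x. \<bar>f x\<bar>)) * norm (abs_l2 (\<lambda>_. 1))"
    by (rule norm_cauchy_schwarz)
  also have "norm (abs_l2 (\<lambda>_. 1)) = 1"
    using norm_abs_l2_sq[OF L2_fun_const[of 1]] norm_ge_zero[of "abs_l2 (\<lambda>_. 1)"]
    by (auto simp: measure_restrict_space power2_eq_1_iff)
  also have "norm (abs_l2 (\<lambda>x. \<bar>f x\<bar>)) = norm (abs_l2 f)"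
    by (rule power2_eq_imp_eq) (simp_all add: norm_abs_l2_sq f assms)
  finally show ?thesis by simp
qed

lemma l2_dominated_convergence:
  assumes f: "f \<in> borel_measurable leb01" and s: "\<And>n. s n \<in> borel_measurable leb01"
    and w: "w \<in> L2_fun"
    and bound: "\<And>n. AE x in leb01. \<bar>s n x\<bar> \<le> w x"
    and lim: "AE x in leb01. (\<lambda>n. s n x) \<longlonglongrightarrow> f x"
  shows "f \<in> L2_fun" "(\<lambda>n. abs_l2 (s n)) \<longlonglongrightarrow> abs_l2 f"
proof -
  have bound_all: "AE x in leb01. \<forall>n. \<bar>s n x\<bar> \<le> w x"
    using bound by (simp add: AE_all_countable)
  have fw: "AE x in leb01. \<bar>f x\<bar> \<le> w x"
    using bound_all lim
  proof eventually_elim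
    case (elim x)
    then show ?case by (intro LIMSEQ_le_const2[OF tendsto_rabs[OF elim(2)]]) auto
  qed
  then show fL2: "f \<in> L2_fun"
    by (intro L2_fun_dominated[OF f w]) (auto elim: eventually_mono)
  have sL2: "s n \<in> L2_fun" for n
    by (rule L2_fun_dominated[OF s w]) (use bound[of n] in eventually_elim, simp)
  have "(\<lambda>n. LINT x|leb01. (s n x - f x)\<^sup>2) \<longlonglongrightarrow> (LINT x|leb01. 0)"
  proof (rule integral_dominated_convergence[where w = "\<lambda>x. 4 * (w x)\<^sup>2"])
    show "integrable leb01 (\<lambda>x. 4 * (w x)\<^sup>2)" using w by (simp add: L2_fun_iff)
    show "AE x in leb01. (\<lambda>n. (s n x - f x)\<^sup>2) \<longlonglongrightarrow> 0"
      using lim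
    proof eventually_elim
      case (elim x)
      have "(\<lambda>n. (s n x - f x)\<^sup>2) \<longlonglongrightarrow> (f x - f x)\<^sup>2" by (intro tendsto_intros elim)
      then show ?case by simp
    qed
    show "AE x in leb01. norm ((s n x - f x)\<^sup>2) \<le> 4 * (w x)\<^sup>2" for n
      using bound[of n] fw
    proof eventually_elim
      case (elim x)
      then have "\<bar>s n x - f x\<bar> \<le> \<bar>2 * w x\<bar>" by linarith
      then have "(s n x - f x)\<^sup>2 \<le> (2 * w x)\<^sup>2" by (simp only: abs_le_square_iff)
      then show ?case by (simp add: power_mult_distrib)
    qed
  qed (use f s in measurable)
  then have "(\<lambda>n. (norm (abs_l2 (s n) - abs_l2 f))\<^sup>2) \<longlonglongrightarrow> 0"
    by (simp add: abs_l2_diff[symmetric] sL2 fL2 norm_abs_l2_sq L2_fun_diff)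
  then have "(\<lambda>n. sqrt ((norm (abs_l2 (s n) - abs_l2 f))\<^sup>2)) \<longlonglongrightarrow> sqrt 0"
    by (rule tendsto_real_sqrt)
  then have "(\<lambda>n. norm (abs_l2 (s n) - abs_l2 f)) \<longlonglongrightarrow> 0" by simp
  then show "(\<lambda>n. abs_l2 (s n)) \<longlonglongrightarrow> abs_l2 f"
    by (simp add: tendsto_norm_zero_iff LIM_zero_iff)
qed

text \<open>Riesz--Fischer\<close>

instance l2 :: complete_space
proof
  fix X :: "nat \<Rightarrow> l2" assume X: "Cauchy X"
  have "\<exists>N. \<forall>i\<ge>N. \<forall>j\<ge>N. dist (X i) (X j) < (1/2) ^ n" for n :: nat
    using metric_CauchyD[OF X, of "(1/2) ^ n"] by simp
  then obtain N where N: "\<And>n i j. i \<ge> N n \<Longrightarrow> j \<ge> N n \<Longrightarrow> dist (X i) (X j) < (1/2::real) ^ n"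
    by metis
  define r where "r n = n + (\<Sum>k\<le>n. N k)" for n
  have rN: "r m \<ge> N n" if "n \<le> m" for m n
  proof -
    have "N n \<le> (\<Sum>k\<le>m. N k)" using that by (intro member_le_sum) auto
    then show ?thesis by (simp add: r_def)
  qed
  define f where "f n = rep_l2 (X (r n))" for n
  have fL2: "f n \<in> L2_fun" for n by (simp add: f_def rep_l2_in)
  have fm [measurable]: "f n \<in> borel_measurable leb01" for n using fL2 by (rule L2_fun_measurable)
  have dL2: "(\<lambda>x. f (Suc n) x - f n x) \<in> L2_fun" for n by (intro L2_fun_diff fL2)
  have L1: "(LINT x|leb01. \<bar>f (Suc n) x - f n x\<bar>) \<le> (1/2) ^ n" for n
  proof -
    have "(LINT x|leb01. \<bar>f (Suc n) x - f n x\<bar>) \<le> norm (abs_l2 (\<lambda>x. f (Suc n) x - f n x))"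
      by (rule L2_fun_L1_bound[OF dL2])
    also have "\<dots> = dist (X (r (Suc n))) (X (r n))"
      by (simp add: abs_l2_diff fL2 dist_norm) (simp add: f_def)
    also have "\<dots> \<le> (1/2) ^ n"
      by (intro less_imp_le[OF N] rN) auto
    finally show ?thesis .
  qed
  have nn: "(\<integral>\<^sup>+x. (\<Sum>n. ennreal \<bar>f (Suc n) x - f n x\<bar>) \<partial>leb01) < \<infinity>"
  proof -
    have "(\<integral>\<^sup>+x. (\<Sum>n. ennreal \<bar>f (Suc n) x - f n x\<bar>) \<partial>leb01)
        = (\<Sum>n. \<integral>\<^sup>+x. ennreal \<bar>f (Suc n) x - f n x\<bar> \<partial>leb01)"
      by (rule nn_integral_suminf) measurable
    also have "\<dots> = (\<Sum>n. ennreal (LINT x|leb01. \<bar>f (Suc n) x - f n x\<bar>))"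
      by (intro suminf_cong nn_integral_eq_integral integrable_abs L2_fun_integrable dL2) auto
    also have "\<dots> \<le> (\<Sum>n. ennreal ((1/2) ^ n))"
      by (intro suminf_le ennreal_leI L1) auto
    also have "\<dots> = ennreal (\<Sum>n. (1/2::real) ^ n)"
      by (rule suminf_ennreal2) (auto intro: summable_geometric)
    also have "\<dots> < \<infinity>" by simp
    finally show ?thesis .
  qed
  have "AE x in leb01. (\<Sum>n. ennreal \<bar>f (Suc n) x - f n x\<bar>) \<noteq> \<infinity>"
    by (rule nn_integral_noteq_infinite) (use nn in \<open>auto simp: less_top\<close>)
  then have conv: "AE x in leb01. convergent (\<lambda>n. f n x)"
  proof eventually_elim
    case (elim x)
    then have "summable (\<lambda>n. \<bar>f (Suc n) x - f n x\<bar>)"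
      by (intro summable_suminf_not_top) auto
    then have "summable (\<lambda>n. f (Suc n) x - f n x)" by (rule summable_rabs_cancel)
    then have "convergent (\<lambda>n. \<Sum>i<n. f (Suc i) x - f i x)" by (simp add: summable_iff_convergent)
    then have "convergent (\<lambda>n. f n x - f 0 x)" 
      using sum_lessThan_telescope[of "\<lambda>n. f n x"] by simp
    then have "convergent (\<lambda>n. (f n x - f 0 x) + f 0 x)"
      by (intro convergent_add convergent_const)
    then show ?case by simp
  qed
  define g where "g x = lim (\<lambda>n. f n x)" for x
  have gm [measurable]: "g \<in> borel_measurable leb01" unfolding g_def
    by (rule borel_measurable_lim_metric) measurable
  have glim: "AE x in leb01. (\<lambda>n. f n x) \<longlonglongrightarrow> g x"
    using conv by eventually_elim (auto simp: g_def convergent_LIMSEQ_iff)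
  have key: "integrable leb01 (\<lambda>x. (g x - f n x)\<^sup>2) \<and>
      (LINT x|leb01. (g x - f n x)\<^sup>2) \<le> ((1/2) ^ n)\<^sup>2" for n
  proof -
    have le: "(\<integral>\<^sup>+x. ennreal ((f m x - f n x)\<^sup>2) \<partial>leb01) \<le> ennreal (((1/2) ^ n)\<^sup>2)" if "m \<ge> n" for m
    proof -
      have "(\<integral>\<^sup>+x. ennreal ((f m x - f n x)\<^sup>2) \<partial>leb01)
          = ennreal (LINT x|leb01. (f m x - f n x)\<^sup>2)"
        using L2_fun_diff[OF fL2 fL2, of m n]
        by (intro nn_integral_eq_integral) (auto simp: L2_fun_iff)
      also have "(LINT x|leb01. (f m x - f n x)\<^sup>2) = (norm (abs_l2 (f m) - abs_l2 (f n)))\<^sup>2"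
        by (simp add: abs_l2_diff[symmetric] fL2 norm_abs_l2_sq L2_fun_diff)
      also have "\<dots> = (dist (X (r m)) (X (r n)))\<^sup>2" by (simp add: f_def dist_norm)
      also have "\<dots> \<le> ((1/2) ^ n)\<^sup>2"
        by (intro power_mono less_imp_le[OF N] rN that) auto
      finally show ?thesis by (simp add: ennreal_leI)
    qed
    have "(\<integral>\<^sup>+x. ennreal ((g x - f n x)\<^sup>2) \<partial>leb01)
        = (\<integral>\<^sup>+x. liminf (\<lambda>m. ennreal ((f m x - f n x)\<^sup>2)) \<partial>leb01)"
    proof (rule nn_integral_cong_AE, use glim in eventually_elim)
      case (elim x)
      have "(\<lambda>m. ennreal ((f m x - f n x)\<^sup>2)) \<longlonglongrightarrow> ennreal ((g x - f n x)\<^sup>2)"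
        by (intro tendsto_ennrealI tendsto_intros elim)
      then show ?case
        by (intro lim_imp_Liminf[symmetric]) simp_all
    qed
    also have "\<dots> \<le> liminf (\<lambda>m. \<integral>\<^sup>+x. ennreal ((f m x - f n x)\<^sup>2) \<partial>leb01)"
      by (rule nn_integral_liminf) measurable
    also have "\<dots> \<le> ennreal (((1/2) ^ n)\<^sup>2)"
      by (rule order_trans[OF Liminf_le_Limsup Limsup_bounded])
        (use le in \<open>auto simp: eventually_sequentially\<close>)
    finally have bd: "(\<integral>\<^sup>+x. ennreal ((g x - f n x)\<^sup>2) \<partial>leb01) \<le> ennreal (((1/2) ^ n)\<^sup>2)" .
    have int: "integrable leb01 (\<lambda>x. (g x - f n x)\<^sup>2)"
      by (rule integrableI_bounded) (use bd in \<open>auto simp: le_less_trans\<close>)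
    have "ennreal (LINT x|leb01. (g x - f n x)\<^sup>2) \<le> ennreal (((1/2) ^ n)\<^sup>2)"
      using bd by (simp add: nn_integral_eq_integral[OF int])
    then show ?thesis using int by (simp add: ennreal_le_iff)
  qed
  have "(\<lambda>x. g x - f n x) \<in> L2_fun" for n using key[of n] by (simp add: L2_fun_iff)
  from L2_fun_add[OF this[of 0] fL2[of 0]] have gL2: "g \<in> L2_fun" by simp
  have close: "norm (abs_l2 g - X (r n)) \<le> (1/2) ^ n" for n
  proof (rule power2_le_imp_le)
    have "(norm (abs_l2 g - abs_l2 (f n)))\<^sup>2 \<le> ((1/2) ^ n)\<^sup>2"
      using key[of n] by (simp add: abs_l2_diff[symmetric] gL2 fL2 norm_abs_l2_sq L2_fun_diff)
    then show "(norm (abs_l2 g - X (r n)))\<^sup>2 \<le> ((1/2) ^ n)\<^sup>2" by (simp add: f_def)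
  qed simp
  have "X \<longlonglongrightarrow> abs_l2 g"
  proof (rule metric_LIMSEQ_I)
    fix e :: real assume e: "e > 0"
    obtain n :: nat where n: "(1/2::real) ^ n < e / 2"
      using real_arch_pow_inv[of "e/2" "1/2"] e by auto
    have "dist (X i) (abs_l2 g) < e" if "i \<ge> N n" for i
    proof -
      have "dist (X i) (X (r n)) < (1/2) ^ n" by (intro N that rN) simp
      moreover have "dist (X (r n)) (abs_l2 g) \<le> (1/2) ^ n"
        using close[of n] by (simp add: dist_norm norm_minus_commute)
      ultimately show ?thesis using n dist_triangle[of "X i" "abs_l2 g" "X (r n)"] by linarith
    qed
    then show "\<exists>M. \<forall>i\<ge>M. dist (X i) (abs_l2 g) < e" by blast
  qed
  then show "convergent X" by (auto simp: convergent_def)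
qed

instance l2 :: banach ..

lemma l2_dense_closed_subspace:
  assumes C: "closed C" "subspace C"
    and gen: "\<And>q. q \<in> \<rat> \<Longrightarrow> abs_l2 (indicator {..<q}) \<in> C"
  shows "v \<in> C"
proof -
  have ind_m: "(indicator A :: real \<Rightarrow> real) \<in> borel_measurable leb01" if "A \<in> sets borel" for A :: "real set"
  proof -
    have "(indicator A :: real \<Rightarrow> real) \<in> borel_measurable lebesgue"
      using that by (intro borel_measurable_indicator) simp
    then show ?thesis by (rule measurable_restrict_space1)
  qed
  have ind: "(indicator A :: real \<Rightarrow> real) \<in> L2_fun" if "A \<in> sets borel" for A
    by (rule L2_fun_bounded[OF ind_m[OF that], of 1]) (auto simp: indicator_def)
  have lim: "abs_l2 f \<in> C"
    if "f \<in> borel_measurable leb01" "\<And>n. s n \<in> borel_measurable leb01" "w \<in> L2_fun"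
       "\<And>n x. \<bar>s n x\<bar> \<le> w x" "\<And>x. (\<lambda>n. s n x) \<longlonglongrightarrow> f x" "\<And>n. abs_l2 (s n) \<in> C"
    for f w and s :: "nat \<Rightarrow> real \<Rightarrow> real"
  proof -
    have "(\<lambda>n. abs_l2 (s n)) \<longlonglongrightarrow> abs_l2 f"
      by (rule l2_dominated_convergence(2)[OF that(1,2,3)]) (use that(4,5) in auto)
    then show ?thesis
      using closed_sequentially[OF C(1), of "\<lambda>n. abs_l2 (s n)"] that(6) by simp
  qed
  have half_line: "abs_l2 (indicator {..<a}) \<in> C" for a
  proof -
    have "\<exists>q\<in>\<rat>. a - 1 / Suc n < q \<and> q < a" for n
      by (rule Rats_dense_in_real) simp
    then obtain q where q: "\<And>n. q n \<in> \<rat>" "\<And>n. a - 1 / Suc n < q n" "\<And>n. q n < a" by metis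
    have q_lim: "q \<longlonglongrightarrow> a"
    proof (rule tendsto_sandwich[of "\<lambda>n. a - 1 / Suc n" _ _ "\<lambda>_. a"])
      show "(\<lambda>n. a - 1 / real (Suc n)) \<longlonglongrightarrow> a"
        using tendsto_diff[OF tendsto_const LIMSEQ_Suc[OF lim_1_over_n], of a] by simp
    qed (use q in \<open>auto intro!: always_eventually less_imp_le simp del: of_nat_Suc\<close>)
    show ?thesis
    proof (rule lim[where w = "\<lambda>_. 1" and s = "\<lambda>n. indicator {..<q n}"])
      fix x
      show "(\<lambda>n. indicator {..<q n} x :: real) \<longlonglongrightarrow> indicator {..<a} x"
      proof (cases "x < a")
        case True
        have "\<forall>\<^sub>F n in sequentially. x < q n" by (rule order_tendstoD(1)[OF q_lim True])
        then show ?thesis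
          using True by (intro tendsto_eventually) (auto elim: eventually_mono)
      next
        case False
        then have "\<not> x < q n" for n using q(3)[of n] by linarith
        then show ?thesis using False by simp
      qed
      show "(\<lambda>_. 1) \<in> L2_fun" by (rule L2_fun_const)
    qed (auto intro: ind_m gen q simp: indicator_def)
  qed
  have whole: "abs_l2 (indicator UNIV) \<in> C"
  proof -
    have "abs_l2 (indicator UNIV) = abs_l2 (indicator {..<1})"
      by (subst abs_l2_eq_iff) (auto intro!: ind AE_I2 L2_fun_const)
    then show ?thesis using half_line by simp
  qed
  have borel_ind: "abs_l2 (indicator A) \<in> C" if "A \<in> sets borel" for A :: "real set"
  proof -
    have eq: "sets borel = sigma_sets UNIV (range (lessThan :: real \<Rightarrow> real set))"
      by (subst borel_Iio) (simp add: sets_measure_of)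
    have "Int_stable (range (lessThan :: real \<Rightarrow> real set))"
      unfolding Int_stable_def
    proof clarsimp
      fix a b :: real
      have "{..<a} \<inter> {..<b} = {..<min a b}" by auto
      then show "{..<a} \<inter> {..<b} \<in> range lessThan" by simp
    qed
    moreover have "range (lessThan :: real \<Rightarrow> real set) \<subseteq> Pow UNIV" by simp
    moreover have "A \<in> sigma_sets UNIV (range lessThan)" using that eq by simp
    ultimately show ?thesis
    proof (induction rule: sigma_sets_induct_disjoint)
      case (basic A)
      then show ?case using half_line by auto
    next
      case empty
      have "abs_l2 (indicator {}) = 0"
        unfolding zero_l2_def by (rule arg_cong[of _ _ abs_l2]) (auto simp: indicator_def)
      then show ?case using subspace_0[OF C(2)] by (simp only:)
    next
      case (compl A)
      have A: "A \<in> sets borel" using compl(1) eq by simp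
      have "indicator (UNIV - A) = (\<lambda>x. indicator UNIV x - indicator A x :: real)"
        by (auto simp: indicator_def)
      then have "abs_l2 (indicator (UNIV - A)) = abs_l2 (indicator UNIV) - abs_l2 (indicator A)"
        using abs_l2_diff[OF ind ind, of UNIV A] A by (metis borel_open open_UNIV)
      then show ?case using subspace_diff[OF C(2) whole compl(2)] by (simp only:)
    next
      case (union A)
      have A: "A n \<in> sets borel" for n using union(2) eq by auto
      have L2s: "(\<lambda>x. \<Sum>i<n. indicator (A i) x :: real) \<in> L2_fun \<and>
          abs_l2 (\<lambda>x. \<Sum>i<n. indicator (A i) x) \<in> C" for n
      proof (induction n)
        case 0
        have "abs_l2 (\<lambda>_. 0) = 0" by (simp add: zero_l2_def)
        then show ?case using subspace_0[OF C(2)] L2_fun_const[of 0] by simp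
      next
        case (Suc n)
        then show ?case
          using union(3)[of n] abs_l2_add[OF _ ind[OF A[of n]]] L2_fun_add[OF _ ind[OF A[of n]]]
            subspace_add[OF C(2)] by simp
      qed
      have sum_eq: "(\<Sum>i<n. indicator (A i) x :: real) = indicator (\<Union>i<n. A i) x" for n x
        using union(1)
        by (subst indicator_UN_disjoint) (auto simp: disjoint_family_on_def)
      show ?case
      proof (rule lim[where w = "\<lambda>_. 1" and s = "\<lambda>n x. \<Sum>i<n. indicator (A i) x"])
        show "\<bar>\<Sum>i<n. indicator (A i) x :: real\<bar> \<le> 1" for n x
          unfolding sum_eq by (simp add: indicator_def)
        show "(\<lambda>n. \<Sum>i<n. indicator (A i) x :: real) \<longlonglongrightarrow> indicator (\<Union>i. A i) x" for x
          unfolding sum_eq by (rule LIMSEQ_indicator_UN)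
        show "(\<lambda>_. 1) \<in> L2_fun" by (rule L2_fun_const)
      qed (use A L2s in \<open>auto intro: ind_m L2_fun_measurable\<close>)
    qed
  qed
  have simple: "s \<in> L2_fun \<and> abs_l2 s \<in> C" if s: "simple_function borel s" for s :: "real \<Rightarrow> real"
  proof -
    have fin: "finite (range s)" using simple_functionD(1)[OF s] by simp
    have pre: "s -` {y} \<in> sets borel" for y using simple_functionD(2)[OF s, of "{y}"] by simp
    define a where "a y x = y * indicator (s -` {y}) x" for y x :: real
    have a: "a y \<in> L2_fun" "abs_l2 (a y) \<in> C" for y
      unfolding a_def using abs_l2_scale[OF ind[OF pre[of y]], of y]
        subspace_scale[OF C(2) borel_ind[OF pre[of y]], of y]
      by (simp_all only: L2_fun_scale[OF ind[OF pre[of y]]])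
    have "(\<lambda>x. \<Sum>y\<in>Y. a y x) \<in> L2_fun \<and> abs_l2 (\<lambda>x. \<Sum>y\<in>Y. a y x) \<in> C" if "finite Y" for Y
      using that
    proof (induction Y)
      case empty
      have "abs_l2 (\<lambda>_. 0) = 0" by (simp add: zero_l2_def)
      then show ?case using subspace_0[OF C(2)] L2_fun_const[of 0] by simp
    next
      case (insert y Y)
      then show ?case
        using a[of y] abs_l2_add[of "a y"] L2_fun_add[of "a y"] subspace_add[OF C(2)] by simp
    qed
    moreover have "(\<lambda>x. \<Sum>y\<in>range s. a y x) = s"
    proof
      fix x
      have "(\<Sum>y\<in>range s. a y x) = (\<Sum>y\<in>range s. if y = s x then y else 0)"
        by (rule sum.cong) (auto simp: a_def indicator_def)
      also have "\<dots> = s x" using fin by simp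
      finally show "(\<Sum>y\<in>range s. a y x) = s x" .
    qed
    ultimately show ?thesis using fin by metis
  qed
  define f where "f = rep_l2 v"
  have fL2: "f \<in> L2_fun" by (simp add: f_def rep_l2_in)
  have "(\<lambda>x. indicator {0<..<1} x *\<^sub>R f x) \<in> borel_measurable lebesgue"
    using L2_fun_measurable[OF fL2] by (subst (asm) borel_measurable_restrict_space_iff) auto
  then obtain g where g: "g \<in> borel_measurable lborel"
    and gf: "AE x in lborel. indicator {0<..<1} x *\<^sub>R f x = g x"
    using completion_ex_borel_measurable_real by blast
  have gm: "g \<in> borel_measurable leb01"
    by (rule measurable_restrict_space1) (use g in \<open>auto intro: measurable_completion\<close>)
  have gf': "AE x in leb01. g x = f x"
  proof -
    have "AE x in lebesgue. x \<in> {0<..<1} \<longrightarrow> g x = f x"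
      using AE_completion[OF gf] by eventually_elim auto
    then show ?thesis by (subst AE_restrict_space_iff) auto
  qed
  have gL2: "g \<in> L2_fun"
    by (rule L2_fun_dominated[OF gm fL2]) (use gf' in eventually_elim, simp)
  have "g \<in> borel_measurable borel" using g by simp
  from borel_measurable_implies_sequence_metric[OF this, of 0]
  obtain s where s: "\<And>i. simple_function borel (s i)" "\<And>x. (\<lambda>i. s i x) \<longlonglongrightarrow> g x"
    "\<And>i x. dist (s i x) 0 \<le> 2 * dist (g x) 0" by (simp only: space_borel UNIV_I) blast
  have "abs_l2 g \<in> C"
  proof (rule lim[where w = "\<lambda>x. 2 * \<bar>g x\<bar>" and s = s])
    show "(\<lambda>x. 2 * \<bar>g x\<bar>) \<in> L2_fun"
      by (intro L2_fun_scale L2_fun_dominated[OF _ gL2]) (use gm in auto)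
    show "g \<in> borel_measurable leb01" by (rule gm)
    show "\<bar>s n x\<bar> \<le> 2 * \<bar>g x\<bar>" for n x using s(3)[of n x] by (simp add: dist_norm)
    show "s n \<in> borel_measurable leb01" "abs_l2 (s n) \<in> C" for n
      using simple[OF s(1)[of n]] by (simp_all add: L2_fun_measurable)
    show "(\<lambda>i. s i x) \<longlonglongrightarrow> g x" for x by (rule s(2))
  qed
  moreover have "abs_l2 g = v"
    using abs_l2_eq_iff[OF gL2 fL2] gf' by (simp add: f_def)
  ultimately show ?thesis by simp
qed

instance l2 :: second_countable_topology
proof
  define g where "g n = abs_l2 (indicator {..<of_rat (from_nat n :: rat)})" for n :: nat
  obtain X where X: "countable X" "range g \<subseteq> X" "subspace (closure X)"
    using countable_dense_subspace[of g] by blast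
  have "abs_l2 (indicator {..<q}) \<in> closure X" if "q \<in> \<rat>" for q
  proof -
    from that obtain r :: rat where "q = of_rat r" by (auto simp: Rats_def)
    then have "abs_l2 (indicator {..<q}) = g (to_nat r)" by (simp add: g_def)
    then show ?thesis using X(2) closure_subset by (metis rangeI subsetD)
  qed
  then have dense: "v \<in> closure X" for v
    by (rule l2_dense_closed_subspace[OF closed_closure X(3)])
  show "\<exists>B::l2 set set. countable B \<and> open = generate_topology B"
    by (rule second_countable_of_dense[OF X(1)]) (use dense in \<open>auto simp: closure_approachable\<close>)
qed

section \<open>The Sobolev space\<close>

lemma test_function_L2:
  assumes "\<eta> \<in> test_functions"
  shows "\<eta> \<in> L2_fun" "deriv \<eta> \<in> L2_fun"
proof -
  have L2: "h \<in> L2_fun" if h: "continuous_on UNIV h" for h :: "real \<Rightarrow> real"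
  proof -
    have "compact (h ` {0..1})"
      by (rule compact_continuous_image) (use h continuous_on_subset in auto)
    then obtain B where B: "\<And>x. x \<in> {0..1} \<Longrightarrow> \<bar>h x\<bar> \<le> B"
      using compact_imp_bounded bounded_iff by (metis imageI real_norm_def)
    have "h \<in> borel_measurable borel" using h by (rule borel_measurable_continuous_onI)
    then have "h \<in> borel_measurable lebesgue" by (intro measurable_completion) simp
    then have "h \<in> borel_measurable leb01" by (rule measurable_restrict_space1)
    then show ?thesis by (rule L2_fun_bounded[where B = B]) (rule AE_I2, use B in simp)
  qed
  have "(deriv ^^ k) \<eta> differentiable_on UNIV" for k
    using assms by (simp add: test_functions_def)
  from this[of 0] this[of 1] show "\<eta> \<in> L2_fun" "deriv \<eta> \<in> L2_fun"
    by (auto intro!: L2 differentiable_imp_continuous_on)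
qed

lemma loc_integrable_L2:
  assumes "f \<in> L2_fun"
  shows "loc_integrable f"
  unfolding loc_integrable_def
proof (intro allI impI)
  fix K :: "real set" assume K: "compact K \<and> K \<subseteq> {0<..<1}"
  have "set_integrable lebesgue {0<..<1} f"
    using L2_fun_integrable[OF assms] by (simp add: integrable_restrict_space set_integrable_def)
  moreover have "K \<in> sets lebesgue" using K by (simp add: borel_compact)
  ultimately show "set_integrable lebesgue K f"
    by (rule set_integrable_subset) (use K in simp)
qed

lemma has_weak_deriv_l2_iff:
  "has_weak_deriv (rep_l2 v) (rep_l2 w) \<longleftrightarrow>
     (\<forall>\<eta>\<in>test_functions. inner (abs_l2 (deriv \<eta>)) v = - inner (abs_l2 \<eta>) w)"
proof -
  have "inner (abs_l2 h) v = (LINT t|leb01. h t * rep_l2 v t)" if "h \<in> L2_fun" for h v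
    using inner_abs_l2[OF that rep_l2_in, of v] by simp
  then show ?thesis
    by (simp add: has_weak_deriv_def loc_integrable_L2 rep_l2_in test_function_L2)
qed

text \<open>A Sobolev function is stored together with its weak derivative. Weak derivatives being unique,
  the first component determines the element.\<close>

typedef h1 = "{p :: l2 \<times> l2. has_weak_deriv (rep_l2 (fst p)) (rep_l2 (snd p))}"
  morphisms rep_h1 abs_h1
  by (rule exI[of _ "(0, 0)"]) (simp add: has_weak_deriv_l2_iff)

lemma rep_h1_in: "has_weak_deriv (rep_l2 (fst (rep_h1 v))) (rep_l2 (snd (rep_h1 v)))"
  using rep_h1[of v] by simp

definition h1_val :: "h1 \<Rightarrow> l2" where "h1_val v = fst (rep_h1 v)"

definition h1_grad :: "h1 \<Rightarrow> l2" where "h1_grad v = snd (rep_h1 v)"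

instantiation h1 :: real_inner
begin

definition zero_h1 :: h1 where "0 = abs_h1 0"

definition plus_h1 :: "h1 \<Rightarrow> h1 \<Rightarrow> h1" where "v + w = abs_h1 (rep_h1 v + rep_h1 w)"

definition minus_h1 :: "h1 \<Rightarrow> h1 \<Rightarrow> h1" where "v - w = abs_h1 (rep_h1 v - rep_h1 w)"

definition uminus_h1 :: "h1 \<Rightarrow> h1" where "- v = abs_h1 (- rep_h1 v)"

definition scaleR_h1 :: "real \<Rightarrow> h1 \<Rightarrow> h1" where "c *\<^sub>R v = abs_h1 (c *\<^sub>R rep_h1 v)"

definition inner_h1 :: "h1 \<Rightarrow> h1 \<Rightarrow> real" where
  "inner_h1 v w = inner (h1_grad v) (h1_grad w) + inner (h1_val v) (h1_val w)"

definition norm_h1 :: "h1 \<Rightarrow> real" where "norm_h1 v = sqrt (inner v v)"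

definition sgn_h1 :: "h1 \<Rightarrow> h1" where "sgn_h1 v = inverse (norm v) *\<^sub>R v"

definition dist_h1 :: "h1 \<Rightarrow> h1 \<Rightarrow> real" where "dist_h1 v w = norm (v - w)"

definition uniformity_h1 :: "(h1 \<times> h1) filter" where
  "uniformity_h1 = (INF e\<in>{0<..}. principal {(v, w). dist v w < e})"

definition open_h1 :: "h1 set \<Rightarrow> bool" where
  "open_h1 S \<longleftrightarrow> (\<forall>v\<in>S. \<forall>\<^sub>F (v', w) in uniformity. v' = v \<longrightarrow> w \<in> S)"

lemma rep_h1_simps:
  "rep_h1 0 = 0" "rep_h1 (v + w) = rep_h1 v + rep_h1 w" "rep_h1 (v - w) = rep_h1 v - rep_h1 w"
  "rep_h1 (- v) = - rep_h1 v" "rep_h1 (c *\<^sub>R v) = c *\<^sub>R rep_h1 v"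
  unfolding zero_h1_def plus_h1_def minus_h1_def uminus_h1_def scaleR_h1_def
  using rep_h1_in[of v] rep_h1_in[of w]
  by (simp_all add: abs_h1_inverse has_weak_deriv_l2_iff inner_add_right inner_diff_right)

lemma inner_rep_h1: "inner v w = inner (rep_h1 v) (rep_h1 w)" for v w :: h1
  by (simp add: inner_h1_def h1_val_def h1_grad_def inner_prod_def)

instance
proof
  fix a b c :: h1 and r s :: real
  show "a + b + c = a + (b + c)" by (simp add: rep_h1_inject[symmetric] rep_h1_simps algebra_simps)
  show "a + b = b + a" by (simp add: rep_h1_inject[symmetric] rep_h1_simps algebra_simps)
  show "0 + a = a" by (simp add: rep_h1_inject[symmetric] rep_h1_simps algebra_simps)
  show "- a + a = 0" by (simp add: rep_h1_inject[symmetric] rep_h1_simps algebra_simps)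
  show "a - b = a + - b" by (simp add: rep_h1_inject[symmetric] rep_h1_simps algebra_simps)
  show "r *\<^sub>R (a + b) = r *\<^sub>R a + r *\<^sub>R b" by (simp add: rep_h1_inject[symmetric] rep_h1_simps algebra_simps)
  show "(r + s) *\<^sub>R a = r *\<^sub>R a + s *\<^sub>R a" by (simp add: rep_h1_inject[symmetric] rep_h1_simps algebra_simps)
  show "r *\<^sub>R s *\<^sub>R a = (r * s) *\<^sub>R a" by (simp add: rep_h1_inject[symmetric] rep_h1_simps algebra_simps)
  show "1 *\<^sub>R a = a" by (simp add: rep_h1_inject[symmetric] rep_h1_simps algebra_simps)
  show "sgn a = inverse (norm a) *\<^sub>R a" by (rule sgn_h1_def)
  show "dist a b = norm (a - b)" by (rule dist_h1_def)
  show "(uniformity :: (h1 \<times> h1) filter) = (INF e\<in>{0<..}. principal {(v, w). dist v w < e})"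
    by (rule uniformity_h1_def)
  show "open S \<longleftrightarrow> (\<forall>v\<in>S. \<forall>\<^sub>F (v', w) in uniformity. v' = v \<longrightarrow> w \<in> S)" for S :: "h1 set"
    by (rule open_h1_def)
  show "inner a b = inner b a" by (simp add: inner_rep_h1 inner_commute)
  show "inner (a + b) c = inner a c + inner b c"
    by (simp add: inner_rep_h1 rep_h1_simps inner_add_left)
  show "inner (r *\<^sub>R a) b = r * inner a b"
    by (simp add: inner_rep_h1 rep_h1_simps)
  show "0 \<le> inner a a" by (simp add: inner_rep_h1)
  show "inner a a = 0 \<longleftrightarrow> a = 0"
    by (simp add: inner_rep_h1 rep_h1_simps rep_h1_inject[symmetric])
  show "norm a = sqrt (inner a a)" by (rule norm_h1_def)
qed

end

lemma dist_rep_h1: "dist (rep_h1 v) (rep_h1 w) = dist v w"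
  by (simp add: dist_norm norm_eq_sqrt_inner inner_rep_h1 rep_h1_simps)

lemma closed_range_rep_h1: "closed (range rep_h1)"
proof -
  have "range rep_h1 = (\<Inter>\<eta>\<in>test_functions.
      {p. inner (abs_l2 (deriv \<eta>)) (fst p) = - inner (abs_l2 \<eta>) (snd p)})"
    using type_definition.Rep_range[OF type_definition_h1] by (auto simp: has_weak_deriv_l2_iff)
  then show ?thesis
    by (simp only:) (intro closed_INT ballI closed_Collect_eq continuous_intros)
qed

instance h1 :: complete_space
proof
  fix X :: "nat \<Rightarrow> h1" assume "Cauchy X"
  then have "Cauchy (\<lambda>n. rep_h1 (X n))" by (simp add: Cauchy_def dist_rep_h1)
  then obtain p where p: "(\<lambda>n. rep_h1 (X n)) \<longlonglongrightarrow> p"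
    using Cauchy_convergent convergent_def by blast
  then have "p \<in> range rep_h1"
    using closed_sequentially[OF closed_range_rep_h1, of "\<lambda>n. rep_h1 (X n)"] by simp
  then obtain v where v: "p = rep_h1 v" by auto
  have "X \<longlonglongrightarrow> v"
    using p tendsto_dist_iff[of "\<lambda>n. rep_h1 (X n)" "rep_h1 v"] tendsto_dist_iff[of X v]
    by (simp only: v dist_rep_h1)
  then show "convergent X" by (auto simp: convergent_def)
qed

instance h1 :: banach ..

instance h1 :: second_countable_topology
  by standard (rule second_countable_of_isometry[of rep_h1], rule dist_rep_h1)

definition h10 :: "h1 set" where
  "h10 = closure {v. \<exists>\<eta>\<in>test_functions. rep_h1 v = (abs_l2 \<eta>, abs_l2 (deriv \<eta>))}"

section \<open>The Gelfand triple and the space W\<close>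

definition H_to_Vdual :: "l2 \<Rightarrow> h1 \<Rightarrow>\<^sub>L real" where
  "H_to_Vdual h = Blinfun (\<lambda>v. inner h (h1_val v))"

lemma H_to_Vdual_apply [simp]: "H_to_Vdual h v = inner h (h1_val v)"
proof -
  have "bounded_linear (\<lambda>v. inner h (h1_val v))"
  proof (rule bounded_linear_intro[where K = "norm h"])
    fix v w :: h1 and c :: real
    show "inner h (h1_val (v + w)) = inner h (h1_val v) + inner h (h1_val w)"
      by (simp add: h1_val_def rep_h1_simps inner_add_right)
    show "inner h (h1_val (c *\<^sub>R v)) = c *\<^sub>R inner h (h1_val v)"
      by (simp add: h1_val_def rep_h1_simps)
    have "norm (h1_val v) \<le> norm v"
      by (simp add: norm_eq_sqrt_inner inner_h1_def)
    then have "norm h * norm (h1_val v) \<le> norm v * norm h"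
      using mult_left_mono[OF _ norm_ge_zero[of h]] by (simp add: mult.commute[of "norm v"])
    then show "norm (inner h (h1_val v)) \<le> norm v * norm h"
      using Cauchy_Schwarz_ineq2[of h "h1_val v"] by simp
  qed
  then show ?thesis by (simp add: H_to_Vdual_def bounded_linear_Blinfun_apply)
qed

definition W_space :: "(real \<Rightarrow> h1) set" where
  "W_space = {U \<in> bochner_Lp 2.
     \<exists>G \<in> bochner_Lp 2. has_weak_deriv (\<lambda>t. H_to_Vdual (h1_val (U t))) G}"

definition represents :: "(real \<Rightarrow> l2) \<Rightarrow> (real \<Rightarrow> real \<Rightarrow> real) \<Rightarrow> bool" where
  "represents F u \<longleftrightarrow> (AE t in leb01. AE x in leb01. rep_l2 (F t) x = u x t)"

section \<open>The function of the example\<close>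

definition psi :: "nat \<Rightarrow> real \<Rightarrow> real" where
  "psi n x = cos (real n * pi * x)"

definition phi_scaled :: "(real \<Rightarrow> real) \<Rightarrow> nat \<Rightarrow> real \<Rightarrow> real" where
  "phi_scaled \<phi> n t = real (n * (n + 1)) * \<phi> (real (n * (n + 1)) * t - real n)"

text \<open>The series starts at \<open>n = 1\<close>. If \<open>\<phi>\<close> vanishes outside \<open>(0,1)\<close>, then \<open>phi_scaled \<phi> n\<close> vanishes
  outside \<open>(1/(n+1), 1/n)\<close>, so that for every \<open>t\<close> at most one term is nonzero.\<close>

definition example_u :: "(real \<Rightarrow> real) \<Rightarrow> real \<Rightarrow> real \<Rightarrow> real" where
  "example_u \<phi> x t = (\<Sum>k. real (Suc k) powi (-3) * phi_scaled \<phi> (Suc k) t * psi (Suc k) x)"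

end

theory Submission
  imports Defs
begin

text \<open>
  At any time at most one term of the series is active: the \<open>n\<close>-th one lives on \<open>(1/(n+1), 1/n)\<close>, for a
  time \<open>1/m\<close> with \<open>m = n (n + 1)\<close>, and there \<open>u\<close> equals \<open>a \<phi>(m t - n) cos(n \<pi> x)\<close> with an amplitude
  \<open>a = n\<^sup>-\<^sup>3 m\<close> of order \<open>1/n\<close>. Since the durations \<open>1/m\<close> are summable, such a train of pulses is square
  integrable in time as soon as its amplitudes are bounded in the space under consideration
  (\<open>pulses_Lp2\<close>). Membership in \<open>W\<close> thus reduces to two estimates. The norm of \<open>cos(n \<pi> x)\<close> in \<open>V\<close> is of
  order \<open>n\<close>, so the amplitudes of \<open>u\<close> in \<open>V\<close> are bounded. Differentiation in time multiplies the amplitude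
  by \<open>m\<close>, but the norm of \<open>cos(n \<pi> x)\<close> in \<open>V\<^sup>*\<close> is of order \<open>1/n\<close> because of its oscillation
  (\<open>norm_psi_dual\<close>), so the amplitudes \<open>a m / n\<close> of the derivative in \<open>V\<^sup>*\<close> are bounded too. That the
  termwise derivative is the weak derivative (\<open>has_weak_deriv_pulses\<close>) rests on \<open>\<phi> \<in> H\<^sup>1\<^sub>0\<close>: its
  extension by zero has no jumps.

  Since \<open>\<phi> \<ge> 0\<close>, taking the positive part replaces the cosine by its positive part, which has mean
  at least \<open>1/4\<close>. The gain of a factor \<open>1/n\<close> in \<open>V\<^sup>*\<close> is lost (\<open>norm_psi_pos_dual\<close>): the amplitudes in
  \<open>V\<^sup>*\<close> are now at least a multiple of \<open>1/n\<close>. On each of the disjoint intervals the \<open>L\<^sup>1\<close> norm of a weak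
  derivative is at least a multiple of the amplitude reached there, so an integrable weak derivative would
  make the amplitudes summable (\<open>summable_amplitudes\<close>). The harmonic series diverges.

  The estimate in \<open>V\<^sup>*\<close> integrates \<open>cos(n \<pi> x)\<close> by parts against an arbitrary element of \<open>V\<close>, and thereby
  needs \<open>sin(n \<pi> x)\<close> to be a limit of test functions in \<open>H\<^sup>1\<close> (\<open>approximation_by_test_functions\<close>).
  The required cutoffs are antiderivatives of rescaled copies of a test function of nonzero mean. The
  function \<open>\<phi>\<close> itself provides one: it is nonnegative and not zero, so its mean is positive, and it is a
  limit of test functions.
\<close>

section \<open>Smooth functions on the line\<close>

definition smooth :: "(real \<Rightarrow> real) \<Rightarrow> bool" where
  "smooth f \<longleftrightarrow> (\<forall>k. (deriv ^^ k) f differentiable_on UNIV)"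

lemma smooth_has_deriv:
  assumes "smooth f"
  shows "(f has_real_derivative deriv f x) (at x)"
proof -
  have "(deriv ^^ 0) f differentiable_on UNIV" using assms unfolding smooth_def by blast
  then have "f differentiable at x" by (simp add: differentiable_on_def)
  then show ?thesis by (simp add: DERIV_deriv_iff_real_differentiable)
qed

lemma smooth_deriv: "smooth f \<Longrightarrow> smooth (deriv f)"
  unfolding smooth_def by (metis funpow_Suc_right o_apply)

lemma smooth_continuous: "smooth f \<Longrightarrow> continuous_on UNIV f"
  using smooth_has_deriv DERIV_isCont by (blast intro: continuous_at_imp_continuous_on)

text \<open>
  The \<open>k\<close>-th derivative of a product or of a composition is never needed in closed form: a family of
  differentiable functions that contains the derivatives of its members consists of smooth functions.
\<close>

lemma smooth_coinduct:
  assumes "f \<in> S" and "\<And>f. f \<in> S \<Longrightarrow> \<exists>f'\<in>S. \<forall>x. (f has_real_derivative f' x) (at x)"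
  shows "smooth f"
proof -
  have step: "(\<forall>x. (g has_real_derivative deriv g x) (at x)) \<and> deriv g \<in> S" if g: "g \<in> S" for g
  proof -
    obtain g' where g': "g' \<in> S" "\<forall>x. (g has_real_derivative g' x) (at x)"
      using assms(2)[OF g] by blast
    then have "deriv g = g'" by (auto intro!: ext DERIV_imp_deriv)
    with g' show ?thesis by simp
  qed
  have "(deriv ^^ k) f \<in> S" for k
    by (induction k) (use assms(1) step in auto)
  then show ?thesis
    unfolding smooth_def differentiable_on_def
    using step by (metis differentiable_at_withinI real_differentiable_def)
qed

lemma smooth_antiderivative:
  assumes "smooth f" and "\<And>x. (F has_real_derivative f x) (at x)"
  shows "smooth F"
proof (rule smooth_coinduct[of F "insert F (Collect smooth)"])
  fix g assume "g \<in> insert F (Collect smooth)"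
  then show "\<exists>g'\<in>insert F (Collect smooth). \<forall>x. (g has_real_derivative g' x) (at x)"
    using assms smooth_has_deriv smooth_deriv by blast
qed simp

lemma smooth_const: "smooth (\<lambda>_. c)"
  by (rule smooth_coinduct[of _ "range (\<lambda>c _. c)"]) (auto intro: exI[of _ 0])

lemma smooth_affine:
  assumes "smooth f"
  shows "smooth (\<lambda>x. f (a * x + b))"
proof (rule smooth_coinduct[of _ "{\<lambda>x. c * g (a * x + b) | c g. smooth g}"])
  show "(\<lambda>x. f (a * x + b)) \<in> {\<lambda>x. c * g (a * x + b) | c g. smooth g}"
    using assms by (auto intro!: exI[of _ 1] exI[of _ f])
next
  fix h assume "h \<in> {\<lambda>x. c * g (a * x + b) | c g. smooth g}"
  then obtain c g where h: "h = (\<lambda>x. c * g (a * x + b))" "smooth g" by blast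
  have "(h has_real_derivative (c * a) * deriv g (a * x + b)) (at x)" for x
    unfolding h(1) by (auto intro!: derivative_eq_intros DERIV_chain2[OF smooth_has_deriv[OF h(2)]])
  then show "\<exists>h'\<in>{\<lambda>x. c * g (a * x + b) | c g. smooth g}. \<forall>x. (h has_real_derivative h' x) (at x)"
    using smooth_deriv[OF h(2)] by (intro bexI[of _ "\<lambda>x. (c * a) * deriv g (a * x + b)"]) blast+
qed

text \<open>The closure of the products under the product rule.\<close>

inductive_set product_sums :: "(real \<Rightarrow> real) set" where
  product: "smooth f \<Longrightarrow> smooth g \<Longrightarrow> (\<lambda>x. f x * g x) \<in> product_sums"
| plus: "f \<in> product_sums \<Longrightarrow> g \<in> product_sums \<Longrightarrow> (\<lambda>x. f x + g x) \<in> product_sums"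

lemma smooth_mult:
  assumes "smooth f" "smooth g"
  shows "smooth (\<lambda>x. f x * g x)"
proof (rule smooth_coinduct[of _ product_sums])
  show "(\<lambda>x. f x * g x) \<in> product_sums" using assms by (rule product_sums.product)
next
  fix h assume "h \<in> product_sums"
  then show "\<exists>h'\<in>product_sums. \<forall>x. (h has_real_derivative h' x) (at x)"
  proof induction
    case (product f g)
    have "((\<lambda>x. f x * g x) has_real_derivative deriv f x * g x + f x * deriv g x) (at x)" for x
      using smooth_has_deriv[OF product(1), of x] smooth_has_deriv[OF product(2), of x]
      by (auto intro!: derivative_eq_intros)
    moreover have "(\<lambda>x. deriv f x * g x + f x * deriv g x) \<in> product_sums"
      using product by (intro product_sums.intros smooth_deriv)
    ultimately show ?case by (intro bexI allI)
  next
    case (plus f g)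
    then obtain f' g' where "f' \<in> product_sums" "\<forall>x. (f has_real_derivative f' x) (at x)"
      "g' \<in> product_sums" "\<forall>x. (g has_real_derivative g' x) (at x)" by blast
    then show ?case
      by (intro bexI[of _ "\<lambda>x. f' x + g' x"]) (auto intro: product_sums.plus DERIV_add)
  qed
qed

lemma smooth_sin: "smooth (\<lambda>x. sin (a * x))"
proof (rule smooth_coinduct[of _ "{\<lambda>x. c * sin (a * x + b) | c b. True}"])
  show "(\<lambda>x. sin (a * x)) \<in> {\<lambda>x. c * sin (a * x + b) | c b. True}"
    by (intro CollectI exI[of _ 1] exI[of _ 0]) simp
next
  fix h assume "h \<in> {\<lambda>x. c * sin (a * x + b) | c b. True}"
  then obtain c b where h: "h = (\<lambda>x. c * sin (a * x + b))" by blast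
  have "(h has_real_derivative (c * a) * sin (a * x + (b + pi / 2))) (at x)" for x
    unfolding h by (auto intro!: derivative_eq_intros simp: add.assoc[symmetric] sin_add[of _ "pi/2"])
  then show "\<exists>h'\<in>{\<lambda>x. c * sin (a * x + b) | c b. True}. \<forall>x. (h has_real_derivative h' x) (at x)"
    by (intro bexI[of _ "\<lambda>x. (c * a) * sin (a * x + (b + pi / 2))"]) blast+
qed

lemma continuous_bounded_unit:
  fixes f :: "real \<Rightarrow> real"
  assumes "continuous_on UNIV f"
  obtains B where "0 \<le> B" "\<And>x. x \<in> {0..1} \<Longrightarrow> \<bar>f x\<bar> \<le> B"
proof -
  have "compact (f ` {0..1})"
    using assms continuous_on_subset by (intro compact_continuous_image) auto
  then obtain B where B: "\<And>x. x \<in> {0..1} \<Longrightarrow> \<bar>f x\<bar> \<le> B"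
    using compact_imp_bounded bounded_iff by (metis imageI real_norm_def)
  have "0 \<le> \<bar>f 0\<bar>" by simp
  also have "\<dots> \<le> B" by (rule B) simp
  finally show ?thesis using B that by blast
qed

section \<open>Test functions\<close>

lemma test_function_smooth: "\<eta> \<in> test_functions \<Longrightarrow> smooth \<eta>"
  by (simp add: test_functions_def smooth_def)

lemma test_functionI:
  assumes "smooth \<eta>" "compact K" "K \<subseteq> {0<..<1}" and supp: "\<And>t. t \<notin> K \<Longrightarrow> \<eta> t = 0"
  shows "\<eta> \<in> test_functions"
proof -
  have sub: "closure {t. \<eta> t \<noteq> 0} \<subseteq> K"
    using supp compact_imp_closed[OF assms(2)] by (intro closure_minimal) auto
  moreover have "compact (closure {t. \<eta> t \<noteq> 0})"
    using compact_Int_closed[OF assms(2), of "closure {t. \<eta> t \<noteq> 0}"] sub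
    by (simp add: Int_absorb1)
  ultimately show ?thesis
    using assms(1,3) by (auto simp: test_functions_def smooth_def)
qed

lemma deriv_zero_off_closed:
  fixes f :: "real \<Rightarrow> real"
  assumes "closed K" "\<And>t. t \<notin> K \<Longrightarrow> f t = 0" "t \<notin> K"
  shows "deriv f t = 0"
proof -
  have "open (- K)" using assms(1) by (rule open_Compl)
  then have "(f has_real_derivative 0) (at t)"
    by (rule has_field_derivative_transform_within_open[of "\<lambda>_. 0" 0 t "- K", OF DERIV_const])
      (use assms in auto)
  then show ?thesis by (rule DERIV_imp_deriv)
qed

lemma test_function_support:
  assumes "\<eta> \<in> test_functions"
  obtains K where "compact K" "K \<subseteq> {0<..<1}" "\<And>t. t \<notin> K \<Longrightarrow> \<eta> t = 0" "\<And>t. t \<notin> K \<Longrightarrow> deriv \<eta> t = 0"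
proof -
  let ?K = "closure {t. \<eta> t \<noteq> 0}"
  have K: "compact ?K" "?K \<subseteq> {0<..<1}" using assms by (auto simp: test_functions_def)
  have zero: "\<eta> t = 0" if "t \<notin> ?K" for t using that closure_subset[of "{t. \<eta> t \<noteq> 0}"] by auto
  moreover have "deriv \<eta> t = 0" if "t \<notin> ?K" for t
    by (rule deriv_zero_off_closed[OF compact_imp_closed[OF K(1)] zero that])
  ultimately show ?thesis using that K by blast
qed

lemma test_function_deriv:
  assumes "\<eta> \<in> test_functions"
  shows "deriv \<eta> \<in> test_functions"
proof -
  obtain K where "compact K" "K \<subseteq> {0<..<1}" "\<And>t. t \<notin> K \<Longrightarrow> deriv \<eta> t = 0"
    using test_function_support[OF assms] by metis
  then show ?thesis
    using smooth_deriv[OF test_function_smooth[OF assms]] by (intro test_functionI[of _ K])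
qed

lemma test_function_outside:
  assumes "\<eta> \<in> test_functions" "t \<notin> {0<..<1}"
  shows "\<eta> t = 0"
  using assms test_function_support[OF assms(1)] by (metis subsetD)

lemma test_function_bounded:
  assumes "\<eta> \<in> test_functions"
  obtains B where "\<And>t. \<bar>\<eta> t\<bar> \<le> B"
proof -
  obtain B where B: "0 \<le> B" "\<And>x. x \<in> {0..1} \<Longrightarrow> \<bar>\<eta> x\<bar> \<le> B"
    using continuous_bounded_unit[OF smooth_continuous[OF test_function_smooth[OF assms]]] by blast
  have "\<bar>\<eta> t\<bar> \<le> B" for t
  proof (cases "t \<in> {0..1}")
    case False
    then have "\<eta> t = 0" using test_function_outside[OF assms] by auto
    then show ?thesis using B(1) by simp
  qed (rule B(2))
  then show ?thesis by (rule that)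
qed

section \<open>Integration by parts\<close>

lemma L2_fun_continuous:
  assumes "continuous_on UNIV f"
  shows "f \<in> L2_fun"
proof -
  obtain B where B: "0 \<le> B" "\<And>x. x \<in> {0..1} \<Longrightarrow> \<bar>f x\<bar> \<le> B"
    using continuous_bounded_unit[OF assms] by blast
  have "f \<in> borel_measurable borel" using assms by (rule borel_measurable_continuous_onI)
  then have "f \<in> borel_measurable lebesgue" by (intro measurable_completion) simp
  then have "f \<in> borel_measurable leb01" by (rule measurable_restrict_space1)
  then show ?thesis by (rule L2_fun_bounded[where B = B]) (rule AE_I2, use B(2) in simp)
qed

lemma AE_leb01_iff: "(AE t in leb01. P t) \<longleftrightarrow> (AE t in lebesgue. t \<in> {0<..<1} \<longrightarrow> P t)"
  by (subst AE_restrict_space_iff) auto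

lemma integral_leb01: "(LINT t|leb01. f t) = (LINT t|lebesgue. indicator {0<..<1} t *\<^sub>R f t)"
  for f :: "real \<Rightarrow> 'b::{banach, second_countable_topology}"
  by (rule integral_restrict_space) simp

lemma FTC_leb01:
  assumes "\<And>x. (F has_real_derivative f x) (at x)" "continuous_on UNIV f"
  shows "(LINT x|leb01. f x) = F 1 - F 0"
proof -
  have "(LINT x|leb01. f x) = integral {0<..<1} f"
    by (rule lebesgue_integral_eq_integral)
      (use L2_fun_integrable[OF L2_fun_continuous[OF assms(2)]] in auto)
  also have "\<dots> = integral {0..1} f" by (simp add: integral_open_interval_real)
  also have "\<dots> = F 1 - F 0"
    using assms(1)
    by (intro integral_unique fundamental_theorem_of_calculus)
      (auto simp: has_real_derivative_iff_has_vector_derivative[symmetric] intro: DERIV_subset)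
  finally show ?thesis .
qed

lemma integration_by_parts_C1:
  assumes f: "\<And>x. (f has_real_derivative f' x) (at x)" "continuous_on UNIV f'"
    and g: "\<And>x. (g has_real_derivative g' x) (at x)" "continuous_on UNIV g'"
    and boundary: "f 1 * g 1 = f 0 * g 0"
  shows "inner (abs_l2 f') (abs_l2 g) = - inner (abs_l2 f) (abs_l2 g')"
proof -
  have c: "continuous_on UNIV f" "continuous_on UNIV g"
    using f(1) g(1) DERIV_isCont by (blast intro: continuous_at_imp_continuous_on)+
  note L2 = L2_fun_continuous[OF f(2)] L2_fun_continuous[OF g(2)] 
    L2_fun_continuous[OF c(1)] L2_fun_continuous[OF c(2)]
  have "(LINT x|leb01. f' x * g x + f x * g' x) = f 1 * g 1 - f 0 * g 0"
    using f g c by (intro FTC_leb01) (auto intro!: derivative_eq_intros continuous_intros)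
  moreover have "(LINT x|leb01. f' x * g x + f x * g' x) =
      (LINT x|leb01. f' x * g x) + (LINT x|leb01. f x * g' x)"
    by (intro Bochner_Integration.integral_add L2_fun_mult_integrable L2)
  ultimately show ?thesis using boundary by (simp add: inner_abs_l2 L2)
qed

lemma test_function_by_parts:
  assumes "\<eta> \<in> test_functions"
    and f: "\<And>x. (f has_real_derivative f' x) (at x)" "continuous_on UNIV f'"
  shows "inner (abs_l2 (deriv \<eta>)) (abs_l2 f) = - inner (abs_l2 \<eta>) (abs_l2 f')"
proof (rule integration_by_parts_C1[OF _ _ f])
  show "(\<eta> has_real_derivative deriv \<eta> x) (at x)" for x
    by (rule smooth_has_deriv[OF test_function_smooth[OF assms(1)]])
  show "continuous_on UNIV (deriv \<eta>)"
    by (rule smooth_continuous[OF smooth_deriv[OF test_function_smooth[OF assms(1)]]])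
qed (simp add: test_function_outside[OF assms(1)])

text \<open>Meaningful if \<open>f'\<close> is the continuous derivative of \<open>f\<close>.\<close>

definition h1_of :: "(real \<Rightarrow> real) \<Rightarrow> (real \<Rightarrow> real) \<Rightarrow> h1" where
  "h1_of f f' = abs_h1 (abs_l2 f, abs_l2 f')"

lemma h1_of:
  assumes f: "\<And>x. (f has_real_derivative f' x) (at x)" "continuous_on UNIV f'"
  shows "h1_val (h1_of f f') = abs_l2 f" "h1_grad (h1_of f f') = abs_l2 f'"
proof -
  have "inner (abs_l2 (deriv \<eta>)) (abs_l2 f) = - inner (abs_l2 \<eta>) (abs_l2 f')"
    if "\<eta> \<in> test_functions" for \<eta>
    using that f by (rule test_function_by_parts)
  then have "has_weak_deriv (rep_l2 (abs_l2 f)) (rep_l2 (abs_l2 f'))"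
    by (simp add: has_weak_deriv_l2_iff)
  then show "h1_val (h1_of f f') = abs_l2 f" "h1_grad (h1_of f f') = abs_l2 f'"
    by (simp_all add: h1_of_def h1_val_def h1_grad_def abs_h1_inverse)
qed

lemma h1_weak_deriv:
  "\<eta> \<in> test_functions \<Longrightarrow> inner (abs_l2 (deriv \<eta>)) (h1_val v) = - inner (abs_l2 \<eta>) (h1_grad v)"
  using rep_h1_in[of v] by (simp add: has_weak_deriv_l2_iff h1_val_def h1_grad_def)

lemma continuous_rep_h1: "continuous_on UNIV rep_h1"
  by (rule continuous_onI) (metis dist_rep_h1 less_imp_le)

lemma continuous_h1_val: "continuous_on UNIV h1_val"
  and continuous_h1_grad: "continuous_on UNIV h1_grad"
  unfolding h1_val_def[abs_def] h1_grad_def[abs_def]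
  by (intro continuous_intros continuous_rep_h1)+

text \<open>
  Test functions are dense in \<open>h10\<close> by definition, so that an identity between continuous expressions
  passes from them to all of \<open>h10\<close>.
\<close>

lemma h10_induct:
  assumes "v \<in> h10" "closed {v. P v}"
    and "\<And>\<eta> v. \<eta> \<in> test_functions \<Longrightarrow> h1_val v = abs_l2 \<eta> \<Longrightarrow> h1_grad v = abs_l2 (deriv \<eta>) \<Longrightarrow> P v"
  shows "P v"
proof -
  have "h10 \<subseteq> {v. P v}"
    unfolding h10_def using assms(2,3)
    by (intro closure_minimal) (auto simp: h1_val_def h1_grad_def)
  then show ?thesis using assms(1) by blast
qed

text \<open>
  The test function is now \<open>v\<close> itself, so that \<open>f\<close> is free of boundary conditions. Later this lets the
  extension of \<open>\<phi>\<close> by zero be differentiated across the end points of its interval.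
\<close>

lemma h10_by_parts:
  assumes "v \<in> h10" and f: "\<And>x. (f has_real_derivative f' x) (at x)" "continuous_on UNIV f'"
  shows "inner (abs_l2 f') (h1_val v) = - inner (abs_l2 f) (h1_grad v)"
proof (rule h10_induct[OF assms(1)])
  show "closed {v. inner (abs_l2 f') (h1_val v) = - inner (abs_l2 f) (h1_grad v)}"
    by (intro closed_Collect_eq continuous_intros continuous_h1_val continuous_h1_grad)
next
  fix \<eta> and v :: h1
  assume "\<eta> \<in> test_functions" "h1_val v = abs_l2 \<eta>" "h1_grad v = abs_l2 (deriv \<eta>)"
  then show "inner (abs_l2 f') (h1_val v) = - inner (abs_l2 f) (h1_grad v)"
    using test_function_by_parts[OF _ f] by (simp add: inner_commute)
qed

lemma abs_l2_zero: "abs_l2 (\<lambda>_. 0) = 0"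
  by (simp add: zero_l2_def)

text \<open>
  If \<open>v\<close> were orthogonal to all derivatives of test functions, its gradient would be orthogonal to all
  test functions. Derivatives of test functions are test functions and approximate the gradient, which
  would therefore vanish; integration by parts against the identity function would then give mean zero.
\<close>

lemma h10_nonzero_mean_not_orthogonal:
  assumes "v \<in> h10" "inner (abs_l2 (\<lambda>_. 1)) (h1_val v) \<noteq> 0"
  shows "\<exists>\<eta>\<in>test_functions. inner (abs_l2 (deriv \<eta>)) (h1_val v) \<noteq> 0"
proof (rule ccontr)
  assume "\<not> ?thesis"
  then have *: "inner (abs_l2 \<eta>) (h1_grad v) = 0" if "\<eta> \<in> test_functions" for \<eta>
    using that h1_weak_deriv[OF that, of v] by simp
  have "inner (h1_grad w) (h1_grad v) = 0" if "w \<in> h10" for w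
  proof (rule h10_induct[OF that])
    show "closed {w. inner (h1_grad w) (h1_grad v) = 0}"
      by (intro closed_Collect_eq continuous_intros continuous_h1_grad)
  qed (simp add: * test_function_deriv)
  then have "h1_grad v = 0" using assms(1) inner_eq_zero_iff by blast
  moreover have "inner (abs_l2 (\<lambda>_. 1)) (h1_val v) = - inner (abs_l2 (\<lambda>x. x)) (h1_grad v)"
    by (rule h10_by_parts[OF assms(1)]) (auto intro!: derivative_eq_intros)
  ultimately show False using assms(2) by simp
qed

text \<open>
  The mean is continuous, so some of the test functions approximating \<open>v\<close> have nonzero mean as well. The
  cutoff functions below are constructed from such a test function.
\<close>

lemma h10_nonzero_mean_test_function:
  assumes "v \<in> h10" "inner (abs_l2 (\<lambda>_. 1)) (h1_val v) \<noteq> 0"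
  shows "\<exists>\<rho>\<in>test_functions. (LINT x|leb01. \<rho> x) \<noteq> 0"
proof (rule ccontr)
  assume "\<not> ?thesis"
  then have *: "(LINT x|leb01. \<eta> x) = 0" if "\<eta> \<in> test_functions" for \<eta>
    using that by blast
  have "inner (abs_l2 (\<lambda>_. 1)) (h1_val v) = 0"
  proof (rule h10_induct[OF assms(1)])
    show "closed {w. inner (abs_l2 (\<lambda>_. 1)) (h1_val w) = 0}"
      by (intro closed_Collect_eq continuous_intros continuous_h1_val)
  qed (simp add: inner_abs_l2 L2_fun_const test_function_L2 *)
  with assms(2) show False by simp
qed

section \<open>Smooth functions vanishing at the end points\<close>

text \<open>The normalised antiderivative of a test function with nonzero mean is a smooth step.\<close>

lemma unit_step:
  assumes \<rho>: "\<rho> \<in> test_functions" and int: "(LINT x|leb01. \<rho> x) \<noteq> 0"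
  obtains R r B where "smooth R" "\<And>x. (R has_real_derivative r x) (at x)"
    "\<And>x. x \<le> 0 \<Longrightarrow> R x = 0" "\<And>x. 1 \<le> x \<Longrightarrow> R x = 1" "\<And>x. x \<notin> {0<..<1} \<Longrightarrow> r x = 0"
    "\<And>x. \<bar>R x\<bar> \<le> B" "\<And>x. \<bar>r x\<bar> \<le> B"
proof -
  have cont: "continuous_on UNIV \<rho>" by (rule smooth_continuous[OF test_function_smooth[OF \<rho>]])
  then have "isCont \<rho> x" for x by (simp add: continuous_on_eq_continuous_at)
  then obtain F where F: "\<And>x. (F has_real_derivative \<rho> x) (at x)"
    using einterval_antiderivative[of "-\<infinity>" "\<infinity>" \<rho>]
    by (auto simp: has_real_derivative_iff_has_vector_derivative)
  have zero: "\<rho> x = 0" if "x \<notin> {0<..<1}" for x using test_function_outside[OF \<rho> that] .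
  have left: "F x = F 0" if "x \<le> 0" for x
  proof (cases "x = 0")
    case False
    with that have "x < 0" by simp
    then obtain z where "x < z" "z < 0" "F 0 - F x = (0 - x) * \<rho> z"
      using MVT2[of x 0 F \<rho>] F by blast
    then show ?thesis using zero[of z] by simp
  qed simp
  have right: "F x = F 1" if "1 \<le> x" for x
  proof (cases "x = 1")
    case False
    with that have "1 < x" by simp
    then obtain z where "1 < z" "z < x" "F x - F 1 = (x - 1) * \<rho> z"
      using MVT2[of 1 x F \<rho>] F by blast
    then show ?thesis using zero[of z] by simp
  qed simp
  define c where "c = F 1 - F 0"
  have c: "c \<noteq> 0" using FTC_leb01[OF F cont] int by (simp add: c_def)
  define R where "R x = (F x - F 0) / c" for x
  define r where "r x = \<rho> x / c" for x
  have R: "(R has_real_derivative r x) (at x)" for x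
    unfolding R_def r_def using c by (auto intro!: derivative_eq_intros F)
  have r_smooth: "smooth r"
    unfolding r_def divide_inverse
    by (intro smooth_mult smooth_const test_function_smooth[OF \<rho>])
  obtain D where D: "\<And>x. \<bar>\<rho> x\<bar> \<le> D" using test_function_bounded[OF \<rho>] by blast
  have R_smooth: "smooth R" by (rule smooth_antiderivative[OF r_smooth R])
  obtain C where C: "\<And>x. x \<in> {0..1} \<Longrightarrow> \<bar>R x\<bar> \<le> C"
    using continuous_bounded_unit[OF smooth_continuous[OF R_smooth]] by blast
  have R0: "R x = 0" if "x \<le> 0" for x using left[OF that] by (simp add: R_def)
  have R1: "R x = 1" if "1 \<le> x" for x using right[OF that] c by (simp add: R_def c_def)
  have "\<bar>R x\<bar> \<le> C" for x
    using C[of x] C[of 0] C[of 1] R0[of x] R0[of 0] R1[of x] R1[of 1] by (cases "x \<le> 0"; cases "1 \<le> x") auto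
  then have RB: "\<bar>R x\<bar> \<le> max C (D / \<bar>c\<bar>)" for x by (simp add: le_max_iff_disj)
  have "\<bar>r x\<bar> \<le> D / \<bar>c\<bar>" for x using D[of x] by (simp add: r_def divide_right_mono)
  then have rB: "\<bar>r x\<bar> \<le> max C (D / \<bar>c\<bar>)" for x by (simp add: le_max_iff_disj)
  have "r x = 0" if "x \<notin> {0<..<1}" for x using zero[OF that] by (simp add: r_def)
  then show ?thesis using that R_smooth R R0 R1 RB rB by blast
qed

text \<open>
  Multiplication by cutoffs \<open>\<kappa>\<^sub>j\<close> that rise from \<open>0\<close> to \<open>1\<close> within distance \<open>2 / j\<close> of the end points
  approximates \<open>s\<close> in \<open>H\<^sup>1\<close>: the derivative of \<open>\<kappa>\<^sub>j\<close> is of order \<open>j\<close>, but only where \<open>s\<close> is of order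
  \<open>1 / j\<close>, so that the product stays bounded and converges to \<open>0\<close> pointwise.
\<close>

lemma approximation_by_test_functions:
  assumes \<rho>: "\<rho> \<in> test_functions" "(LINT x|leb01. \<rho> x) \<noteq> 0"
    and s: "smooth s" "s 0 = 0" "s 1 = 0"
  obtains \<eta> where "\<And>j::nat. \<eta> j \<in> test_functions"
    "(\<lambda>j. abs_l2 (\<eta> j)) \<longlonglongrightarrow> abs_l2 s" "(\<lambda>j. abs_l2 (deriv (\<eta> j))) \<longlonglongrightarrow> abs_l2 (deriv s)"
proof -
  obtain R r B where R: "smooth R" "\<And>x. (R has_real_derivative r x) (at x)"
    "\<And>x. x \<le> 0 \<Longrightarrow> R x = 0" "\<And>x. 1 \<le> x \<Longrightarrow> R x = 1" "\<And>x. x \<notin> {0<..<1} \<Longrightarrow> r x = 0"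
    "\<And>x. \<bar>R x\<bar> \<le> B" "\<And>x. \<bar>r x\<bar> \<le> B"
    using unit_step[OF \<rho>] by metis
  have B0: "0 \<le> B" using R(6)[of 0] by linarith
  obtain L where L: "0 \<le> L" "\<And>x. x \<in> {0..1} \<Longrightarrow> \<bar>deriv s x\<bar> \<le> L"
    using continuous_bounded_unit[OF smooth_continuous[OF smooth_deriv[OF s(1)]]] by blast
  obtain M where M: "0 \<le> M" "\<And>x. x \<in> {0..1} \<Longrightarrow> \<bar>s x\<bar> \<le> M"
    using continuous_bounded_unit[OF smooth_continuous[OF s(1)]] by blast
  \<comment> \<open>With boundary value \<open>0\<close> at both ends, this bounds \<open>s\<close> by \<open>L\<close> times the distance to the boundary.\<close>
  have lip: "\<bar>s x - s y\<bar> \<le> L * \<bar>x - y\<bar>" if "x \<in> {0..1}" "y \<in> {0..1}" for x y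
    using field_differentiable_bound[of "{0..1}" s "deriv s" L y x] L(2) that
    by (auto intro: has_field_derivative_at_within smooth_has_deriv[OF s(1)] simp: abs_minus_commute)
  \<comment> \<open>The shift by \<open>1\<close> makes the cutoff vanish within distance \<open>1 / j\<close> of the end points, so that its
    support is compact in \<open>(0,1)\<close>. The arguments are written in the form \<open>a * x + b\<close> of \<open>smooth_affine\<close>.\<close>
  define \<kappa> where "\<kappa> j x = R (real j * x + - 1) * R ((- real j) * x + (real j - 1))" for j :: nat and x
  define \<kappa>' where "\<kappa>' j x = real j * r (real j * x + - 1) * R ((- real j) * x + (real j - 1))
      - real j * R (real j * x + - 1) * r ((- real j) * x + (real j - 1))" for j :: nat and x
  have \<kappa>_smooth: "smooth (\<kappa> j)" for j
    unfolding \<kappa>_def by (intro smooth_mult smooth_affine R(1))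
  have \<kappa>_deriv: "(\<kappa> j has_real_derivative \<kappa>' j x) (at x)" for j x
    unfolding \<kappa>_def \<kappa>'_def by (auto intro!: derivative_eq_intros DERIV_chain2[OF R(2)])
  define \<eta> where "\<eta> j x = \<kappa> (Suc j) x * s x" for j x
  have \<eta>_smooth: "smooth (\<eta> j)" for j
    unfolding \<eta>_def by (intro smooth_mult \<kappa>_smooth s(1))
  have \<eta>_deriv: "deriv (\<eta> j) x = \<kappa>' (Suc j) x * s x + \<kappa> (Suc j) x * deriv s x" for j x
    unfolding \<eta>_def
    by (rule DERIV_imp_deriv) (use \<kappa>_deriv[of "Suc j" x] smooth_has_deriv[OF s(1), of x] 
      in \<open>auto intro!: derivative_eq_intros\<close>)
  have test: "\<eta> j \<in> test_functions" for j
  proof (rule test_functionI[of _ "{1 / real (Suc j)..1 - 1 / real (Suc j)}"])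
    show "\<eta> j t = 0" if "t \<notin> {1 / real (Suc j)..1 - 1 / real (Suc j)}" for t
    proof -
      have "t < 1 / real (Suc j) \<or> 1 - 1 / real (Suc j) < t" using that by auto
      then have "real (Suc j) * t + - 1 \<le> 0 \<or> (- real (Suc j)) * t + (real (Suc j) - 1) \<le> 0"
        by (auto simp: field_simps simp del: of_nat_Suc)
      then show ?thesis using R(3) by (auto simp: \<eta>_def \<kappa>_def simp del: of_nat_Suc)
    qed
    show "{1 / real (Suc j)..1 - 1 / real (Suc j)} \<subseteq> {0<..<1}"
    proof
      fix x assume "x \<in> {1 / real (Suc j)..1 - 1 / real (Suc j)}"
      moreover have "0 < 1 / real (Suc j)" by simp
      ultimately show "x \<in> {0<..<1}" unfolding atLeastAtMost_iff greaterThanLessThan_iff by linarith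
    qed
  qed (use \<eta>_smooth in auto)
  have \<kappa>_bound: "\<bar>\<kappa> j x\<bar> \<le> B * B" for j x
    unfolding \<kappa>_def abs_mult by (intro mult_mono R(6) B0) auto
  have \<kappa>'_bound: "\<bar>\<kappa>' j x * s x\<bar> \<le> 4 * L * B * B" if x: "x \<in> {0<..<1}" for j x
  proof -
    have left: "real j * \<bar>r (real j * x + - 1)\<bar> * \<bar>s x\<bar> \<le> 2 * L * B"
    proof (cases "real j * x + - 1 \<in> {0<..<1}")
      case True
      have "real j * \<bar>s x\<bar> \<le> real j * (L * x)" using lip[of x 0] x s by (intro mult_left_mono) auto
      also have "\<dots> = L * (real j * x)" by simp
      also have "\<dots> \<le> L * 2" using True L(1) by (intro mult_left_mono) auto
      finally have "real j * \<bar>s x\<bar> * \<bar>r (real j * x + - 1)\<bar> \<le> (L * 2) * B"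
        using R(7) L(1) by (auto intro: mult_mono[of "real j * \<bar>s x\<bar>" "L * 2"])
      then show ?thesis by (simp add: mult_ac)
    qed (use R(5) L(1) B0 in simp)
    have right: "real j * \<bar>r ((- real j) * x + (real j - 1))\<bar> * \<bar>s x\<bar> \<le> 2 * L * B"
    proof (cases "(- real j) * x + (real j - 1) \<in> {0<..<1}")
      case True
      have "real j * \<bar>s x\<bar> \<le> real j * (L * (1 - x))"
        using lip[of x 1] x s by (intro mult_left_mono) auto
      also have "\<dots> = L * (real j * (1 - x))" by simp
      also have "\<dots> \<le> L * 2" using True L(1) by (intro mult_left_mono) (auto simp: algebra_simps)
      finally have "real j * \<bar>s x\<bar> * \<bar>r ((- real j) * x + (real j - 1))\<bar> \<le> (L * 2) * B"
        using R(7) L(1) by (auto intro: mult_mono[of "real j * \<bar>s x\<bar>" "L * 2"])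
      then show ?thesis by (simp add: mult_ac)
    qed (use R(5) L(1) B0 in simp)
    have "\<bar>\<kappa>' j x * s x\<bar> \<le> (real j * \<bar>r (real j * x + - 1)\<bar> * \<bar>s x\<bar>) * \<bar>R ((- real j) * x + (real j - 1))\<bar>
      + (real j * \<bar>r ((- real j) * x + (real j - 1))\<bar> * \<bar>s x\<bar>) * \<bar>R (real j * x + - 1)\<bar>"
    proof -
      have "\<bar>(j * a * b - j * c * d) * s\<bar> \<le> j * \<bar>a\<bar> * \<bar>s\<bar> * \<bar>b\<bar> + j * \<bar>d\<bar> * \<bar>s\<bar> * \<bar>c\<bar>" if "0 \<le> j" for a b c d s j :: real
      proof -
        have "(j * a * b - j * c * d) * s = j * a * s * b - j * d * s * c" by (simp add: algebra_simps)
        also have "\<bar>\<dots>\<bar> \<le> \<bar>j * a * s * b\<bar> + \<bar>j * d * s * c\<bar>" by (rule abs_triangle_ineq4)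
        finally show ?thesis using that by (simp add: abs_mult)
      qed
      then show ?thesis unfolding \<kappa>'_def by simp
    qed
    also have "\<dots> \<le> (2 * L * B) * B + (2 * L * B) * B"
      using L(1) B0 by (intro add_mono mult_mono left right R(6)) auto
    finally show ?thesis by (simp add: mult_ac)
  qed
  have eventually: "\<forall>\<^sub>F j in sequentially. \<kappa> (Suc j) x = 1 \<and> \<kappa>' (Suc j) x = 0" if x: "x \<in> {0<..<1}" for x
  proof -
    obtain N where N: "2 / x \<le> real N" "2 / (1 - x) \<le> real N"
      using real_arch_simple[of "max (2 / x) (2 / (1 - x))"] by auto
    have "\<kappa> j x = 1 \<and> \<kappa>' j x = 0" if "N \<le> j" for j
    proof -
      have "2 / x \<le> real j" "2 / (1 - x) \<le> real j" using N that by linarith+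
      then have "2 \<le> real j * x" "2 \<le> real j * (1 - x)" using x by (simp_all add: divide_le_eq)
      then have "1 \<le> real j * x + - 1" "1 \<le> (- real j) * x + (real j - 1)" by (auto simp: algebra_simps)
      then show ?thesis using R(4,5) by (auto simp: \<kappa>_def \<kappa>'_def)
    qed
    then show ?thesis by (auto simp: eventually_sequentially intro!: exI[of _ N])
  qed
  have meas: "smooth f \<Longrightarrow> f \<in> borel_measurable leb01" for f
    by (intro L2_fun_measurable L2_fun_continuous smooth_continuous)
  have "(\<lambda>j. abs_l2 (\<eta> j)) \<longlonglongrightarrow> abs_l2 s"
  proof (rule l2_dominated_convergence[where w = "\<lambda>_. B * B * M"])
    show "AE x in leb01. \<bar>\<eta> j x\<bar> \<le> B * B * M" for j
      unfolding \<eta>_def abs_mult using B0 M \<kappa>_bound by (intro AE_I2 mult_mono) auto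
    show "AE x in leb01. (\<lambda>j. \<eta> j x) \<longlonglongrightarrow> s x"
    proof (rule AE_I2)
      fix x assume "x \<in> space leb01"
      then have "x \<in> {0<..<1}" by simp
      from eventually[OF this] show "(\<lambda>j. \<eta> j x) \<longlonglongrightarrow> s x"
        by (intro tendsto_eventually, elim eventually_mono) (simp add: \<eta>_def)
    qed
  qed (use \<eta>_smooth s(1) in \<open>auto intro: meas L2_fun_const\<close>)
  moreover have "(\<lambda>j. abs_l2 (deriv (\<eta> j))) \<longlonglongrightarrow> abs_l2 (deriv s)"
  proof (rule l2_dominated_convergence[where w = "\<lambda>_. 4 * L * B * B + B * B * L"])
    show "AE x in leb01. \<bar>deriv (\<eta> j) x\<bar> \<le> 4 * L * B * B + B * B * L" for j
    proof (rule AE_I2)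
      fix x assume "x \<in> space leb01"
      then have x: "x \<in> {0<..<1}" by simp
      have "\<bar>\<kappa> (Suc j) x * deriv s x\<bar> \<le> B * B * L"
        unfolding abs_mult using B0 L x \<kappa>_bound by (intro mult_mono) auto
      with \<kappa>'_bound[OF x, of "Suc j"] show "\<bar>deriv (\<eta> j) x\<bar> \<le> 4 * L * B * B + B * B * L"
        unfolding \<eta>_deriv by linarith
    qed
    show "AE x in leb01. (\<lambda>j. deriv (\<eta> j) x) \<longlonglongrightarrow> deriv s x"
    proof (rule AE_I2)
      fix x assume "x \<in> space leb01"
      then have "x \<in> {0<..<1}" by simp
      from eventually[OF this] show "(\<lambda>j. deriv (\<eta> j) x) \<longlonglongrightarrow> deriv s x"
        by (intro tendsto_eventually, elim eventually_mono) (simp add: \<eta>_deriv)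
    qed
  qed (use \<eta>_smooth s(1) in \<open>auto intro: meas L2_fun_const smooth_deriv\<close>)
  ultimately show ?thesis using that test by blast
qed

text \<open>
  The counterpart of \<open>h10_by_parts\<close>: the boundary condition is on \<open>s\<close>, and \<open>v\<close> is any element of \<open>V\<close>.
\<close>

lemma h1_by_parts:
  assumes \<rho>: "\<rho> \<in> test_functions" "(LINT x|leb01. \<rho> x) \<noteq> 0"
    and s: "smooth s" "s 0 = 0" "s 1 = 0"
  shows "inner (abs_l2 (deriv s)) (h1_val v) = - inner (abs_l2 s) (h1_grad v)"
proof -
  obtain \<eta> where \<eta>: "\<And>j::nat. \<eta> j \<in> test_functions"
    "(\<lambda>j. abs_l2 (\<eta> j)) \<longlonglongrightarrow> abs_l2 s" "(\<lambda>j. abs_l2 (deriv (\<eta> j))) \<longlonglongrightarrow> abs_l2 (deriv s)"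
    using approximation_by_test_functions[OF assms] by blast
  have "(\<lambda>j. inner (abs_l2 (deriv (\<eta> j))) (h1_val v)) \<longlonglongrightarrow> inner (abs_l2 (deriv s)) (h1_val v)"
    by (intro tendsto_intros \<eta>)
  moreover have "(\<lambda>j. inner (abs_l2 (deriv (\<eta> j))) (h1_val v)) \<longlonglongrightarrow> - inner (abs_l2 s) (h1_grad v)"
    unfolding h1_weak_deriv[OF \<eta>(1)] by (intro tendsto_intros \<eta>)
  ultimately show ?thesis by (rule LIMSEQ_unique)
qed

section \<open>The cosines\<close>

lemma psi_deriv: "(psi n has_real_derivative - (real n * pi) * sin (real n * pi * x)) (at x)"
  unfolding psi_def[abs_def] by (auto intro!: derivative_eq_intros)

definition psi' :: "nat \<Rightarrow> real \<Rightarrow> real" where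
  "psi' n x = - (real n * pi) * sin (real n * pi * x)"

lemma psi_continuous: "continuous_on UNIV (psi n)" "continuous_on UNIV (psi' n)"
  unfolding psi_def[abs_def] psi'_def[abs_def] by (intro continuous_intros)+

lemma norm_abs_l2_le:
  assumes "f \<in> borel_measurable leb01" "\<And>x. \<bar>f x\<bar> \<le> B"
  shows "norm (abs_l2 f) \<le> B"
proof (rule power2_le_imp_le)
  have B: "0 \<le> B" using assms(2)[of 0] by linarith
  then show "0 \<le> B" .
  have f: "f \<in> L2_fun" by (rule L2_fun_bounded[OF assms(1), of B]) (use assms(2) in simp)
  have "(LINT x|leb01. (f x)\<^sup>2) \<le> (LINT x|leb01. B\<^sup>2)"
    using f L2_fun_const[of B] assms(2) B
    by (intro integral_mono) (auto simp: L2_fun_iff abs_le_square_iff[symmetric])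
  also have "\<dots> = B\<^sup>2" by (simp add: measure_restrict_space)
  finally show "(norm (abs_l2 f))\<^sup>2 \<le> B\<^sup>2" by (simp add: norm_abs_l2_sq f)
qed

definition psi_h1 :: "nat \<Rightarrow> h1" where "psi_h1 n = h1_of (psi n) (psi' n)"

lemma psi_h1: "h1_val (psi_h1 n) = abs_l2 (psi n)" "h1_grad (psi_h1 n) = abs_l2 (psi' n)"
  unfolding psi_h1_def using psi_deriv[of n] psi_continuous(2)[of n]
  by (simp_all add: h1_of psi'_def)

lemma norm_h1_le: "norm v \<le> norm (h1_val v) + norm (h1_grad v)"
proof (rule power2_le_imp_le)
  have "(norm v)\<^sup>2 = (norm (h1_grad v))\<^sup>2 + (norm (h1_val v))\<^sup>2"
    by (simp add: power2_norm_eq_inner inner_h1_def)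
  then show "(norm v)\<^sup>2 \<le> (norm (h1_val v) + norm (h1_grad v))\<^sup>2"
    by (simp add: power2_sum)
qed simp

lemma norm_h1_grad_le: "norm (h1_grad v) \<le> norm v"
  by (simp add: norm_eq_sqrt_inner inner_h1_def)

lemma norm_psi_h1: "norm (psi_h1 n) \<le> 1 + real n * pi"
proof -
  have "norm (abs_l2 (psi n)) \<le> 1"
    by (intro norm_abs_l2_le L2_fun_measurable L2_fun_continuous psi_continuous) (simp add: psi_def)
  moreover have "norm (abs_l2 (psi' n)) \<le> real n * pi"
    by (intro norm_abs_l2_le L2_fun_measurable L2_fun_continuous psi_continuous)
      (auto simp: psi'_def abs_mult intro!: mult_left_le)
  ultimately show ?thesis using norm_h1_le[of "psi_h1 n"] by (simp add: psi_h1)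
qed

text \<open>
  The cosine is \<open>1 / (n \<pi>)\<close> times the derivative of a sine vanishing at both end points. Integration by
  parts moves the derivative to the argument \<open>v\<close>, where the norm of \<open>V\<close> controls it, and the factor
  \<open>1 / (n \<pi>)\<close> remains.
\<close>

lemma norm_psi_dual:
  assumes \<rho>: "\<rho> \<in> test_functions" "(LINT x|leb01. \<rho> x) \<noteq> 0"
  shows "norm (H_to_Vdual (abs_l2 (psi (Suc n)))) \<le> 1 / (real (Suc n) * pi)"
proof (rule norm_blinfun_bound)
  fix v
  let ?a = "real (Suc n) * pi"
  let ?s = "\<lambda>x. sin (?a * x)"
  have a: "?a > 0" by simp
  have "deriv ?s = (\<lambda>x. ?a * psi (Suc n) x)"
    by (intro ext DERIV_imp_deriv) (auto intro!: derivative_eq_intros simp: psi_def)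
  then have "?a *\<^sub>R abs_l2 (psi (Suc n)) = abs_l2 (deriv ?s)"
    by (simp add: abs_l2_scale L2_fun_continuous psi_continuous del: of_nat_Suc)
  then have "?a * inner (abs_l2 (psi (Suc n))) (h1_val v) = inner (abs_l2 (deriv ?s)) (h1_val v)"
    by (metis inner_scaleR_left)
  also have "\<dots> = - inner (abs_l2 ?s) (h1_grad v)"
    using sin_npi[of "Suc n"] by (intro h1_by_parts[OF \<rho>] smooth_sin) (simp_all del: of_nat_Suc)
  finally have "?a * \<bar>inner (abs_l2 (psi (Suc n))) (h1_val v)\<bar> = \<bar>inner (abs_l2 ?s) (h1_grad v)\<bar>"
    using a by (metis abs_minus_cancel abs_mult abs_of_pos)
  also have "\<dots> \<le> norm (abs_l2 ?s) * norm (h1_grad v)" by (rule Cauchy_Schwarz_ineq2)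
  also have "\<dots> \<le> 1 * norm v"
    by (intro mult_mono norm_h1_grad_le norm_abs_l2_le L2_fun_measurable L2_fun_continuous
        smooth_continuous smooth_sin) auto
  finally show "norm (H_to_Vdual (abs_l2 (psi (Suc n))) v) \<le> 1 / ?a * norm v"
    using a by (simp add: field_simps del: of_nat_Suc)
qed simp

lemma L2_fun_psi_pos: "(\<lambda>x. max (psi n x) 0) \<in> L2_fun"
  by (intro L2_fun_continuous continuous_intros psi_continuous)

text \<open>The inequality \<open>max c 0 \<ge> (c + c\<^sup>2) / 2\<close>, valid for \<open>\<bar>c\<bar> \<le> 1\<close>, avoids splitting the interval at the
  zeros of the cosine.\<close>

lemma integral_psi_pos: "1 / 4 \<le> (LINT x|leb01. max (psi (Suc n) x) 0)"
proof -
  let ?a = "real (Suc n) * pi"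
  have a: "?a \<noteq> 0" by simp
  have sin_a: "sin ?a = 0" by (rule sin_npi)
  have "(LINT x|leb01. (psi (Suc n) x + (psi (Suc n) x)\<^sup>2) / 2) =
      (sin (?a * 1) / ?a + 1 / 2 + sin (?a * 1) * cos (?a * 1) / (2 * ?a)) / 2 -
      (sin (?a * 0) / ?a + 0 / 2 + sin (?a * 0) * cos (?a * 0) / (2 * ?a)) / 2"
  proof (rule FTC_leb01[where F = "\<lambda>x. (sin (?a * x) / ?a + x / 2 + sin (?a * x) * cos (?a * x) / (2 * ?a)) / 2"])
    fix x
    have "((\<lambda>x. (sin (?a * x) / ?a + x / 2 + sin (?a * x) * cos (?a * x) / (2 * ?a)) / 2) has_real_derivative
      (cos (?a * x) + 1 / 2 + ((cos (?a * x))\<^sup>2 - (sin (?a * x))\<^sup>2) / 2) / 2) (at x)"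
      using a by (auto intro!: derivative_eq_intros simp: power2_eq_square field_simps simp del: of_nat_Suc)
    moreover have "(cos (?a * x) + 1 / 2 + ((cos (?a * x))\<^sup>2 - (sin (?a * x))\<^sup>2) / 2) / 2 =
        (psi (Suc n) x + (psi (Suc n) x)\<^sup>2) / 2"
      by (simp add: psi_def sin_squared_eq field_simps del: of_nat_Suc)
    ultimately show "((\<lambda>x. (sin (?a * x) / ?a + x / 2 + sin (?a * x) * cos (?a * x) / (2 * ?a)) / 2) has_real_derivative
        (psi (Suc n) x + (psi (Suc n) x)\<^sup>2) / 2) (at x)" by (simp only:)
  qed (intro continuous_intros psi_continuous, simp)
  also have "\<dots> = 1 / 4" using sin_a by (simp del: of_nat_Suc)
  finally have "1 / 4 = (LINT x|leb01. (psi (Suc n) x + (psi (Suc n) x)\<^sup>2) / 2)" ..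
  also have "\<dots> \<le> (LINT x|leb01. max (psi (Suc n) x) 0)"
  proof (rule integral_mono)
    show "integrable leb01 (\<lambda>x. (psi (Suc n) x + (psi (Suc n) x)\<^sup>2) / 2)"
      by (intro L2_fun_integrable L2_fun_continuous continuous_intros psi_continuous) simp
    show "integrable leb01 (\<lambda>x. max (psi (Suc n) x) 0)"
      by (rule L2_fun_integrable[OF L2_fun_psi_pos])
    fix x
    have "(c + c\<^sup>2) / 2 \<le> max c 0" if "\<bar>c\<bar> \<le> 1" for c :: real
    proof (cases "0 \<le> c")
      case True
      then have "c\<^sup>2 \<le> c" using that mult_left_le[of c c] by (simp add: power2_eq_square)
      with True show ?thesis by simp
    next
      case False
      then have "c * (1 + c) \<le> 0" using that by (intro mult_nonpos_nonneg) auto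
      with False show ?thesis by (simp add: power2_eq_square algebra_simps)
    qed
    then show "(psi (Suc n) x + (psi (Suc n) x)\<^sup>2) / 2 \<le> max (psi (Suc n) x) 0"
      by (simp add: psi_def)
  qed
  finally show ?thesis .
qed

text \<open>
  The positive part of the cosine no longer oscillates around zero: paired with the constant \<open>1 \<in> V\<close> it
  stays away from \<open>0\<close>, and the gain of \<open>norm_psi_dual\<close> is lost.
\<close>

lemma norm_psi_pos_dual: "1 / 4 \<le> norm (H_to_Vdual (abs_l2 (\<lambda>x. max (psi (Suc n) x) 0)))"
proof -
  let ?one = "h1_of (\<lambda>_. 1) (\<lambda>_. 0)"
  have one: "h1_val ?one = abs_l2 (\<lambda>_. 1)" "h1_grad ?one = 0"
    using h1_of[of "\<lambda>_. 1" "\<lambda>_. 0"] by (auto simp: abs_l2_zero)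
  have "norm (abs_l2 (\<lambda>_. 1)) \<le> 1" by (rule norm_abs_l2_le) auto
  then have norm_one: "norm ?one \<le> 1" using norm_h1_le[of ?one] by (simp add: one)
  have "1 / 4 \<le> H_to_Vdual (abs_l2 (\<lambda>x. max (psi (Suc n) x) 0)) ?one"
    using integral_psi_pos[of n] by (simp add: one inner_abs_l2 L2_fun_psi_pos L2_fun_const)
  also have "\<dots> \<le> norm (H_to_Vdual (abs_l2 (\<lambda>x. max (psi (Suc n) x) 0))) * norm ?one"
    using norm_blinfun[of "H_to_Vdual (abs_l2 (\<lambda>x. max (psi (Suc n) x) 0))" ?one] by simp
  also have "\<dots> \<le> norm (H_to_Vdual (abs_l2 (\<lambda>x. max (psi (Suc n) x) 0))) * 1"
    using norm_one by (intro mult_left_mono) auto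
  finally show ?thesis by simp
qed

section \<open>Trains of disjoint pulses\<close>

definition rate :: "nat \<Rightarrow> real" where "rate k = real (Suc k * (Suc k + 1))"

definition pulse_arg :: "nat \<Rightarrow> real \<Rightarrow> real" where "pulse_arg k t = rate k * t - (real k + 1)"

text \<open>
  A profile \<open>f\<close> supported in \<open>(0,1)\<close> is squeezed into the intervals \<open>(1/(k+2), 1/(k+1))\<close>, and the copies
  are weighted by vectors \<open>y k\<close>.
\<close>

definition pulses :: "(real \<Rightarrow> real) \<Rightarrow> (nat \<Rightarrow> 'b::{banach, second_countable_topology}) \<Rightarrow> real \<Rightarrow> 'b" where
  "pulses f y t = (\<Sum>k. f (pulse_arg k t) *\<^sub>R y k)"

definition profile :: "(real \<Rightarrow> real) \<Rightarrow> bool" where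
  "profile f \<longleftrightarrow> integrable leb01 f \<and> (\<forall>t. t \<notin> {0<..<1} \<longrightarrow> f t = 0)"

lemma rate_pos: "0 < rate k"
  by (simp add: rate_def del: of_nat_Suc of_nat_mult of_nat_add)

lemma rate_eq: "rate k = (real k + 1) * (real k + 2)"
  by (simp add: rate_def algebra_simps)

lemma profile_outside: "profile f \<Longrightarrow> t \<notin> {0<..<1} \<Longrightarrow> f t = 0"
  by (simp add: profile_def)

lemma pulse_arg_in_iff: "pulse_arg k t \<in> {0<..<1} \<longleftrightarrow> 1 / (real k + 2) < t \<and> t < 1 / (real k + 1)"
proof -
  have "0 < pulse_arg k t \<longleftrightarrow> (real k + 1) * 1 < (real k + 1) * ((real k + 2) * t)"
    by (simp add: pulse_arg_def rate_eq mult.assoc add.commute)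
  also have "\<dots> \<longleftrightarrow> 1 < (real k + 2) * t" by (subst mult_less_cancel_left_pos) auto
  also have "\<dots> \<longleftrightarrow> 1 / (real k + 2) < t" by (simp add: field_simps)
  finally have left: "0 < pulse_arg k t \<longleftrightarrow> 1 / (real k + 2) < t" .
  have "pulse_arg k t < 1 \<longleftrightarrow> (real k + 2) * ((real k + 1) * t) < (real k + 2) * 1"
    by (simp add: pulse_arg_def rate_eq algebra_simps)
  also have "\<dots> \<longleftrightarrow> (real k + 1) * t < 1" by (subst mult_less_cancel_left_pos) auto
  also have "\<dots> \<longleftrightarrow> t < 1 / (real k + 1)" by (simp add: field_simps)
  finally show ?thesis using left by simp
qed

lemma pulse_arg_in_unit: "pulse_arg k t \<in> {0<..<1} \<Longrightarrow> t \<in> {0<..<1}"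
proof -
  assume "pulse_arg k t \<in> {0<..<1}"
  then have *: "1 / (real k + 2) < t" "t < 1 / (real k + 1)" unfolding pulse_arg_in_iff by blast+
  have "0 < 1 / (real k + 2)" "1 / (real k + 1) \<le> 1" by simp_all
  with * show ?thesis unfolding greaterThanLessThan_iff by linarith
qed

lemma pulse_arg_disjoint:
  assumes "pulse_arg j t \<in> {0<..<1}" "pulse_arg k t \<in> {0<..<1}"
  shows "j = k"
proof -
  have *: False if "a < b" "pulse_arg a t \<in> {0<..<1}" "pulse_arg b t \<in> {0<..<1}" for a b
  proof -
    have "real a + 2 \<le> real b + 1" using that(1) by linarith
    then have "1 / (real b + 1) \<le> 1 / (real a + 2)" by (intro divide_left_mono) auto
    then show False using that(2,3) unfolding pulse_arg_in_iff by linarith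
  qed
  show ?thesis using assms *[of j k] *[of k j] by (cases j k rule: linorder_cases) auto
qed

text \<open>An index with this property exists for every time, including the times at which all pulses vanish.\<close>

definition only_pulse :: "nat \<Rightarrow> real \<Rightarrow> bool" where
  "only_pulse k t \<longleftrightarrow> (\<forall>j. j \<noteq> k \<longrightarrow> pulse_arg j t \<notin> {0<..<1})"

lemma ex_only_pulse: obtains k where "only_pulse k t"
  unfolding only_pulse_def using pulse_arg_disjoint by metis

lemma pulses_single:
  assumes "\<forall>t. t \<notin> {0<..<1} \<longrightarrow> f t = 0" "only_pulse k t"
  shows "pulses f y t = f (pulse_arg k t) *\<^sub>R y k"
proof -
  have zero: "f (pulse_arg j t) = 0" if "j \<notin> {k}" for j
    using assms that unfolding only_pulse_def by blast
  then show ?thesis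
    unfolding pulses_def by (subst suminf_finite[of "{k}"]) auto
qed

lemma profile_pulses: "profile f \<Longrightarrow> only_pulse k t \<Longrightarrow> pulses f y t = f (pulse_arg k t) *\<^sub>R y k"
  by (rule pulses_single) (simp add: profile_def)

text \<open>Null sets are preserved by the affine changes of time.\<close>

lemma AE_pulse_arg:
  assumes "AE t in lebesgue. P t"
  shows "AE t in lebesgue. \<forall>k. P (pulse_arg k t)"
  unfolding AE_all_countable
proof
  fix k
  have c: "rate k \<noteq> 0" using rate_pos[of k] by simp
  have m: "(\<lambda>t. - (real k + 1) + rate k * t) \<in> lebesgue \<rightarrow>\<^sub>M lebesgue"
    using lebesgue_affine_measurable[of "\<lambda>_. rate k" "- (real k + 1)"] c by simp
  have "AE t in density (distr lebesgue lebesgue (\<lambda>t. - (real k + 1) + rate k * t)) (\<lambda>_. ennreal \<bar>rate k\<bar>). P t"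
    using assms by (simp only: lebesgue_real_affine[OF c, of "- (real k + 1)", symmetric])
  then have "AE t in distr lebesgue lebesgue (\<lambda>t. - (real k + 1) + rate k * t). P t"
    using c by (simp add: AE_density)
  from AE_distrD[OF m this] show "AE t in lebesgue. P (pulse_arg k t)"
    by (simp add: pulse_arg_def algebra_simps)
qed

lemma integrable_leb01:
  "integrable leb01 f \<longleftrightarrow> integrable lebesgue (\<lambda>t. indicator {0<..<1} t *\<^sub>R f t)"
  for f :: "real \<Rightarrow> 'b::{banach, second_countable_topology}"
  by (rule integrable_restrict_space) simp

text \<open>The change of variables \<open>s = pulse_arg k t\<close>; the pulse being supported in the unit interval, both
  integrals may be taken over the whole line.\<close>

lemma integral_pulse:
  fixes h :: "real \<Rightarrow> real"
  assumes "profile f"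
  shows "(LINT t|leb01. h t * f (pulse_arg k t)) =
      (LINT s|leb01. h ((s + (real k + 1)) / rate k) * f s) / rate k" (is ?eq)
    and "integrable leb01 (\<lambda>t. h t * f (pulse_arg k t)) \<longleftrightarrow>
      integrable leb01 (\<lambda>s. h ((s + (real k + 1)) / rate k) * f s)" (is ?int)
proof -
  note f = profile_outside[OF assms]
  have c: "rate k \<noteq> 0" using rate_pos[of k] by simp
  let ?g = "\<lambda>s. h ((s + (real k + 1)) / rate k) * f s"
  have g: "?g (- (real k + 1) + rate k * t) = h t * f (pulse_arg k t)" for t
    using c by (simp add: pulse_arg_def algebra_simps)
  have ind: "indicator {0<..<1} t *\<^sub>R (h t * f (pulse_arg k t)) = h t * f (pulse_arg k t)" for t
    using f[of "pulse_arg k t"] pulse_arg_in_unit[of k t] by (auto simp: indicator_def)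
  have ind': "indicator {0<..<1} s *\<^sub>R ?g s = ?g s" for s
    using f[of s] by (auto simp: indicator_def)
  have "(LINT t|lebesgue. ?g t) = rate k * (LINT t|lebesgue. h t * f (pulse_arg k t))"
    using lebesgue_integral_real_affine[OF c, of ?g "- (real k + 1)"] rate_pos[of k] unfolding g by simp
  then show ?eq
    unfolding integral_leb01 ind ind' using c by simp
  show ?int
    using lebesgue_integrable_real_affine_iff[OF c, of ?g "- (real k + 1)"]
    unfolding g by (simp add: integrable_leb01 ind ind' del: scaleR_conv_of_real real_scaleR_def)
qed

lemma summable_inverse_rate: "summable (\<lambda>k. 1 / rate k)"
proof (rule summable_comparison_test')
  show "summable (\<lambda>k. inverse ((real (Suc k))\<^sup>2))"
    using inverse_power_summable[of 2, where 'a = real] by (subst summable_Suc_iff) simp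
  fix k :: nat
  have "(real (Suc k))\<^sup>2 \<le> rate k" by (simp add: rate_eq power2_eq_square algebra_simps)
  then show "norm (1 / rate k) \<le> inverse ((real (Suc k))\<^sup>2)"
    using rate_pos[of k] by (simp add: inverse_eq_divide divide_left_mono del: of_nat_Suc)
qed

lemma integrable_bounded_mult:
  fixes h f :: "real \<Rightarrow> real"
  assumes "integrable leb01 f" "h \<in> borel_measurable leb01" "\<And>t. \<bar>h t\<bar> \<le> M"
  shows "integrable leb01 (\<lambda>t. h t * f t)"
proof (rule Bochner_Integration.integrable_bound)
  show "integrable leb01 (\<lambda>t. M * f t)" using assms(1) by simp
  show "AE t in leb01. norm (h t * f t) \<le> norm (M * f t)"
    using assms(3) by (intro AE_I2) (simp add: abs_mult mult_right_mono order_trans[OF _ abs_ge_self])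
qed (use assms in measurable)

text \<open>
  At a fixed time the series has at most one nonzero term. The integrals of the norms of its terms are
  bounded by a multiple of the durations \<open>1 / rate k\<close>, which justifies termwise integration.
\<close>

lemma
  assumes f: "profile f"
    and h: "h \<in> borel_measurable lebesgue" "\<And>t. \<bar>h t\<bar> \<le> M"
    and y: "\<And>k. norm (y k) \<le> B"
  shows integrable_pulses: "integrable leb01 (\<lambda>t. h t *\<^sub>R pulses f y t)"
    and pulses_sums_integral: "(\<lambda>k. (LINT t|leb01. h t * f (pulse_arg k t)) *\<^sub>R y k) sums
      (LINT t|leb01. h t *\<^sub>R pulses f y t)"
proof -
  note f0 = profile_outside[OF f]
  have f1: "integrable leb01 f" using f by (simp add: profile_def)
  have M: "0 \<le> M" using h(2)[of 0] by linarith
  have B: "0 \<le> B" using y[of 0] norm_ge_zero order_trans by blast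
  have h': "(\<lambda>s. h ((s + (real k + 1)) / rate k)) \<in> borel_measurable leb01" for k
  proof -
    have "(\<lambda>s. h ((real k + 1) / rate k + (1 / rate k) *\<^sub>R s)) \<in> borel_measurable lebesgue"
      using rate_pos[of k] by (intro borel_measurable_affine h) auto
    then show ?thesis
      by (intro measurable_restrict_space1) (simp add: add_divide_distrib add.commute)
  qed
  have int: "integrable leb01 (\<lambda>t. h t * f (pulse_arg k t))" for k
    by (simp only: integral_pulse(2)[OF f] integrable_bounded_mult[OF f1 h' h(2)])
  let ?F = "\<lambda>k t. (h t * f (pulse_arg k t)) *\<^sub>R y k"
  have int_F: "integrable leb01 (?F k)" for k by (intro integrable_scaleR_left int)
  have series: "h t *\<^sub>R pulses f y t = (\<Sum>k. ?F k t)" "summable (\<lambda>k. norm (?F k t))" for t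
  proof -
    obtain k where k: "only_pulse k t" using ex_only_pulse by blast
    have zero: "?F j t = 0" if "j \<notin> {k}" for j using f0 k that by (auto simp: only_pulse_def)
    show "summable (\<lambda>k. norm (?F k t))" by (rule summable_finite[of "{k}"]) (simp_all add: zero)
    have "(\<Sum>k. ?F k t) = ?F k t" using suminf_finite[of "{k}" "\<lambda>k. ?F k t"] zero by simp
    then show "h t *\<^sub>R pulses f y t = (\<Sum>k. ?F k t)"
      by (simp add: profile_pulses[OF f k])
  qed
  have bound: "(LINT t|leb01. norm (?F k t)) \<le> B * M * (LINT s|leb01. \<bar>f s\<bar>) * (1 / rate k)" for k
  proof -
    have "(LINT t|leb01. norm (?F k t)) = (LINT t|leb01. \<bar>h t\<bar> * \<bar>f (pulse_arg k t)\<bar>) * norm (y k)"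
      by (simp add: abs_mult)
    also have "(LINT t|leb01. \<bar>h t\<bar> * \<bar>f (pulse_arg k t)\<bar>) =
        (LINT s|leb01. \<bar>h ((s + (real k + 1)) / rate k)\<bar> * \<bar>f s\<bar>) / rate k"
      by (rule integral_pulse(1)) (use f in \<open>simp add: profile_def\<close>)
    also have "(LINT s|leb01. \<bar>h ((s + (real k + 1)) / rate k)\<bar> * \<bar>f s\<bar>) \<le> (LINT s|leb01. M * \<bar>f s\<bar>)"
    proof (rule integral_mono)
      show "integrable leb01 (\<lambda>s. \<bar>h ((s + (real k + 1)) / rate k)\<bar> * \<bar>f s\<bar>)"
        using integrable_abs[OF integrable_bounded_mult[OF f1 h'[of k] h(2)]] by (simp add: abs_mult)
    qed (use f1 h(2) in \<open>auto intro: mult_right_mono\<close>)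
    finally have "(LINT t|leb01. norm (?F k t)) \<le> (M * (LINT s|leb01. \<bar>f s\<bar>)) / rate k * norm (y k)"
      using rate_pos[of k] by (simp add: divide_right_mono mult_right_mono)
    also have "\<dots> \<le> (M * (LINT s|leb01. \<bar>f s\<bar>)) / rate k * B"
      using M rate_pos[of k] y by (intro mult_left_mono divide_nonneg_pos mult_nonneg_nonneg) auto
    finally show ?thesis by (simp add: mult_ac)
  qed
  have sum: "summable (\<lambda>k. LINT t|leb01. norm (?F k t))"
    by (rule summable_comparison_test'[OF summable_mult[OF summable_inverse_rate]])
      (use bound in \<open>simp add: integral_nonneg_AE\<close>)
  show "integrable leb01 (\<lambda>t. h t *\<^sub>R pulses f y t)"
    unfolding series(1) by (rule integrable_suminf[OF int_F AE_I2 sum]) (rule series(2))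
  have "(\<lambda>k. LINT t|leb01. ?F k t) sums (LINT t|leb01. h t *\<^sub>R pulses f y t)"
    unfolding series(1) by (rule sums_integral[OF int_F AE_I2 sum]) (rule series(2))
  then show "(\<lambda>k. (LINT t|leb01. h t * f (pulse_arg k t)) *\<^sub>R y k) sums
      (LINT t|leb01. h t *\<^sub>R pulses f y t)"
    by (simp add: int)
qed

text \<open>
  The \<open>k\<close>-th pulse lasts a time \<open>1 / rate k\<close>, and these durations are summable; square integrability is
  therefore a matter of bounded amplitudes.
\<close>

lemma pulses_Lp2:
  assumes f: "profile f" "f \<in> L2_fun" and y: "\<And>k. norm (y k) \<le> B"
  shows "pulses f y \<in> bochner_Lp 2"
proof -
  have B: "0 \<le> B" using y[of 0] norm_ge_zero order_trans by blast
  have f2: "profile (\<lambda>t. (f t)\<^sup>2)" using f by (simp add: profile_def L2_fun_iff)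
  have meas: "pulses f y \<in> borel_measurable leb01"
    using integrable_pulses[OF f(1) _ _ y, of "\<lambda>_. 1" 1] by (simp add: borel_measurable_integrable)
  have "integrable leb01 (\<lambda>t. pulses (\<lambda>t. (f t)\<^sup>2) (\<lambda>_. B\<^sup>2) t)"
    using integrable_pulses[OF f2, of "\<lambda>_. 1" 1 "\<lambda>_. B\<^sup>2" "B\<^sup>2"] by simp
  then have "integrable leb01 (\<lambda>t. (norm (pulses f y t))\<^sup>2)"
  proof (rule Bochner_Integration.integrable_bound)
    show "AE t in leb01. norm ((norm (pulses f y t))\<^sup>2) \<le> norm (pulses (\<lambda>t. (f t)\<^sup>2) (\<lambda>_. B\<^sup>2) t)"
    proof (rule AE_I2)
      fix t
      obtain k where k: "only_pulse k t" using ex_only_pulse by blast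
      have "(norm (y k))\<^sup>2 \<le> B\<^sup>2" using y by (intro power_mono) auto
      moreover have "pulses f y t = f (pulse_arg k t) *\<^sub>R y k"
        by (rule profile_pulses[OF f(1) k])
      moreover have "pulses (\<lambda>t. (f t)\<^sup>2) (\<lambda>_. B\<^sup>2) t = (f (pulse_arg k t))\<^sup>2 *\<^sub>R B\<^sup>2"
        by (rule profile_pulses[OF f2 k])
      ultimately show "norm ((norm (pulses f y t))\<^sup>2) \<le> norm (pulses (\<lambda>t. (f t)\<^sup>2) (\<lambda>_. B\<^sup>2) t)"
        by (simp add: power_mult_distrib mult_left_mono)
    qed
  qed (use meas in measurable)
  with meas show ?thesis by (simp add: bochner_Lp_def)
qed

lemma loc_integrable_Lp2:
  assumes "F \<in> bochner_Lp 2"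
  shows "loc_integrable F"
  unfolding loc_integrable_def
proof (intro allI impI)
  fix K :: "real set" assume K: "compact K \<and> K \<subseteq> {0<..<1}"
  have "integrable leb01 F"
  proof (rule Bochner_Integration.integrable_bound)
    show "integrable leb01 (\<lambda>t. 1 + (norm (F t))\<^sup>2)"
      using assms finite_measure.integrable_const[OF finite_measure_leb01]
      by (intro Bochner_Integration.integrable_add) (auto simp: bochner_Lp_def)
    have "a \<le> 1 + a\<^sup>2" for a :: real
      using zero_le_power2[of "a - 1/2"] by (simp add: power2_diff power2_eq_square algebra_simps)
    then show "AE t in leb01. norm (F t) \<le> norm (1 + (norm (F t))\<^sup>2)" by simp
  qed (use assms in \<open>simp add: bochner_Lp_def\<close>)
  then have "set_integrable lebesgue {0<..<1} F"
    by (simp add: integrable_restrict_space set_integrable_def)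
  moreover have "K \<in> sets lebesgue" using K by (simp add: borel_compact)
  ultimately show "set_integrable lebesgue K F"
    by (rule set_integrable_subset) (use K in simp)
qed

lemma smooth_pulse: "smooth \<eta> \<Longrightarrow> smooth (\<lambda>s. \<eta> ((s + (real k + 1)) / rate k))"
  using smooth_affine[of \<eta> "1 / rate k" "(real k + 1) / rate k"] by (simp add: add_divide_distrib)

text \<open>
  The identity \<open>by_parts\<close> is required for all smooth \<open>\<zeta>\<close>, not only for test functions. A test function on the
  whole time interval, rescaled to the \<open>k\<close>-th pulse, need not vanish at the ends of the pulse.
\<close>

lemma has_weak_deriv_pulses:
  assumes f: "profile f" "f \<in> L2_fun" and f': "profile f'" "f' \<in> L2_fun"
    and by_parts: "\<And>\<zeta>. smooth \<zeta> \<Longrightarrow> (LINT s|leb01. deriv \<zeta> s * f s) = - (LINT s|leb01. \<zeta> s * f' s)"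
    and w: "\<And>k. norm (rate k *\<^sub>R w k) \<le> B"
  shows "has_weak_deriv (pulses f w) (pulses f' (\<lambda>k. rate k *\<^sub>R w k))"
proof -
  have w': "norm (w k) \<le> B" for k
  proof -
    have "1 \<le> rate k" by (simp add: rate_eq algebra_simps)
    then have "1 * norm (w k) \<le> rate k * norm (w k)" by (intro mult_right_mono) auto
    also have "\<dots> \<le> B" using w[of k] rate_pos[of k] by simp
    finally show ?thesis by simp
  qed
  have "(LINT t|leb01. deriv \<eta> t *\<^sub>R pulses f w t) =
      - (LINT t|leb01. \<eta> t *\<^sub>R pulses f' (\<lambda>k. rate k *\<^sub>R w k) t)" if \<eta>: "\<eta> \<in> test_functions" for \<eta>
  proof -
    have meas: "\<zeta> \<in> borel_measurable lebesgue" if "smooth \<zeta>" for \<zeta>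
      using borel_measurable_continuous_onI[OF smooth_continuous[OF that]]
      by (intro measurable_completion) simp
    note \<eta>_smooth = test_function_smooth[OF \<eta>]
    obtain M where M: "\<And>t. \<bar>\<eta> t\<bar> \<le> M" using test_function_bounded[OF \<eta>] by blast
    obtain M' where M': "\<And>t. \<bar>deriv \<eta> t\<bar> \<le> M'"
      using test_function_bounded[OF test_function_deriv[OF \<eta>]] by blast
    have pulse_by_parts: "(LINT t|leb01. deriv \<eta> t * f (pulse_arg k t)) =
        - rate k * (LINT t|leb01. \<eta> t * f' (pulse_arg k t))" for k
    proof -
      let ?\<zeta> = "\<lambda>s. \<eta> ((s + (real k + 1)) / rate k)"
      have r: "rate k \<noteq> 0" using rate_pos[of k] by simp
      have "deriv ?\<zeta> = (\<lambda>s. deriv \<eta> ((s + (real k + 1)) / rate k) * (1 / rate k))"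
        by (intro ext DERIV_imp_deriv DERIV_chain2[OF smooth_has_deriv[OF \<eta>_smooth]])
          (use r in \<open>auto intro!: derivative_eq_intros\<close>)
      then have "(LINT s|leb01. deriv ?\<zeta> s * f s) =
          (LINT s|leb01. deriv \<eta> ((s + (real k + 1)) / rate k) * f s) / rate k"
        by simp
      with by_parts[OF smooth_pulse[OF \<eta>_smooth, of k]]
      have "(LINT s|leb01. deriv \<eta> ((s + (real k + 1)) / rate k) * f s) / rate k =
          - (LINT s|leb01. ?\<zeta> s * f' s)" by simp
      then show ?thesis
        using r integral_pulse(1)[of f "deriv \<eta>" k, OF f(1)]
          integral_pulse(1)[of f' \<eta> k, OF f'(1)] by simp
    qed
    have "(\<lambda>k. (LINT t|leb01. deriv \<eta> t * f (pulse_arg k t)) *\<^sub>R w k) sums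
        (LINT t|leb01. deriv \<eta> t *\<^sub>R pulses f w t)"
      using meas[OF smooth_deriv[OF \<eta>_smooth]] M' by (rule pulses_sums_integral[OF f(1) _ _ w'])
    moreover have "(\<lambda>k. (LINT t|leb01. \<eta> t * f' (pulse_arg k t)) *\<^sub>R (rate k *\<^sub>R w k)) sums
        (LINT t|leb01. \<eta> t *\<^sub>R pulses f' (\<lambda>k. rate k *\<^sub>R w k) t)"
      using meas[OF \<eta>_smooth] M by (rule pulses_sums_integral[OF f'(1) _ _ w])
    from sums_minus[OF this] have "(\<lambda>k. (LINT t|leb01. deriv \<eta> t * f (pulse_arg k t)) *\<^sub>R w k) sums
        - (LINT t|leb01. \<eta> t *\<^sub>R pulses f' (\<lambda>k. rate k *\<^sub>R w k) t)"
      by (simp add: pulse_by_parts mult.commute)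
    ultimately show ?thesis by (rule sums_unique2)
  qed
  then show ?thesis
    unfolding has_weak_deriv_def
    by (intro conjI ballI loc_integrable_Lp2 pulses_Lp2[OF f w'] pulses_Lp2[OF f' w])
qed

text \<open>
  Squeezing a fixed test function \<open>\<eta>\<close> with \<open>\<integral> \<eta>' f \<noteq> 0\<close> into the \<open>k\<close>-th interval detects the \<open>k\<close>-th
  amplitude: a weak derivative \<open>G\<close> has norm at least a multiple of \<open>norm (w k)\<close> on that interval. The
  intervals being disjoint, \<open>\<Sum>k. norm (w k)\<close> is controlled by the \<open>L\<^sup>1\<close> norm of \<open>G\<close>.
\<close>

lemma summable_amplitudes:
  assumes f: "profile f" "f \<in> L2_fun"
    and \<eta>: "\<eta> \<in> test_functions" "(LINT s|leb01. deriv \<eta> s * f s) \<noteq> 0"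
    and G: "G \<in> bochner_Lp 1" "has_weak_deriv (pulses f w) G"
  shows "summable (\<lambda>k. norm (w k))"
proof -
  note \<eta>_smooth = test_function_smooth[OF \<eta>(1)]
  define A where "A = (LINT s|leb01. deriv \<eta> s * f s)"
  obtain M where M: "\<And>t. \<bar>\<eta> t\<bar> \<le> M" using test_function_bounded[OF \<eta>(1)] by blast
  define \<eta>k where "\<eta>k k t = \<eta> (pulse_arg k t)" for k t
  have G1: "integrable leb01 (\<lambda>t. norm (G t))" and G_meas: "G \<in> borel_measurable leb01"
    using G(1) by (simp_all add: bochner_Lp_def)
  have smooth_k: "smooth (\<eta>k k)" for k
    using smooth_affine[OF \<eta>_smooth, of "rate k" "- (real k + 1)"]
    by (simp add: \<eta>k_def[abs_def] pulse_arg_def algebra_simps)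
  have deriv_k: "deriv (\<eta>k k) t = deriv \<eta> (pulse_arg k t) * rate k" for k t
    unfolding \<eta>k_def[abs_def] pulse_arg_def
    by (rule DERIV_imp_deriv) (auto intro!: derivative_eq_intros DERIV_chain2[OF smooth_has_deriv[OF \<eta>_smooth]])
  have test_k: "\<eta>k k \<in> test_functions" for k
  proof -
    obtain K where K: "compact K" "K \<subseteq> {0<..<1}" "\<And>t. t \<notin> K \<Longrightarrow> \<eta> t = 0"
      using test_function_support[OF \<eta>(1)] by metis
    have r: "rate k \<noteq> 0" using rate_pos[of k] by simp
    have inv: "pulse_arg k ((s + (real k + 1)) / rate k) = s" for s using r by (simp add: pulse_arg_def)
    have inv': "(pulse_arg k t + (real k + 1)) / rate k = t" for t using r by (simp add: pulse_arg_def)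
    show ?thesis
    proof (rule test_functionI[OF smooth_k])
      show "compact ((\<lambda>s. (s + (real k + 1)) / rate k) ` K)"
        using r by (intro compact_continuous_image K(1) continuous_on_divide continuous_on_add
            continuous_on_id continuous_on_const) auto
      show "(\<lambda>s. (s + (real k + 1)) / rate k) ` K \<subseteq> {0<..<1}"
      proof clarify
        fix s assume "s \<in> K"
        with K(2) have "s \<in> {0<..<1}" by blast
        then have "pulse_arg k ((s + (real k + 1)) / rate k) \<in> {0<..<1}" by (simp only: inv)
        then show "(s + (real k + 1)) / rate k \<in> {0<..<1}" by (rule pulse_arg_in_unit)
      qed
      show "\<eta>k k t = 0" if "t \<notin> (\<lambda>s. (s + (real k + 1)) / rate k) ` K" for t
      proof -
        have "pulse_arg k t \<notin> K" using that inv'[of t] by (metis imageI)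
        then show ?thesis using K(3) by (simp add: \<eta>k_def)
      qed
    qed
  qed
  have amplitude: "A *\<^sub>R w k = - (LINT t|leb01. \<eta>k k t *\<^sub>R G t)" for k
  proof -
    have r: "rate k \<noteq> 0" using rate_pos[of k] by simp
    have rescale: "deriv (\<eta>k k) ((s + (real k + 1)) / rate k) * f s = rate k * (deriv \<eta> s * f s)" for s
      using r by (simp add: deriv_k pulse_arg_def)
    have "(LINT t|leb01. deriv (\<eta>k k) t *\<^sub>R pulses f w t) =
        (LINT t|leb01. (deriv (\<eta>k k) t * f (pulse_arg k t)) *\<^sub>R w k)"
    proof (intro Bochner_Integration.integral_cong refl)
      fix t
      show "deriv (\<eta>k k) t *\<^sub>R pulses f w t = (deriv (\<eta>k k) t * f (pulse_arg k t)) *\<^sub>R w k"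
      proof (cases "pulse_arg k t \<in> {0<..<1}")
        case True
        then have "pulses f w t = f (pulse_arg k t) *\<^sub>R w k"
          using pulse_arg_disjoint by (intro profile_pulses[OF f(1)]) (auto simp only: only_pulse_def)
        then show ?thesis by (simp only: scaleR_scaleR)
      next
        case False
        then show ?thesis by (simp add: deriv_k test_function_outside[OF test_function_deriv[OF \<eta>(1)]])
      qed
    qed
    also have "\<dots> = (LINT t|leb01. deriv (\<eta>k k) t * f (pulse_arg k t)) *\<^sub>R w k"
    proof (rule integral_scaleR_left)
      show "integrable leb01 (\<lambda>t. deriv (\<eta>k k) t * f (pulse_arg k t))"
        using L2_fun_mult_integrable[OF test_function_L2(2)[OF \<eta>(1)] f(2)] r
        by (simp add: integral_pulse(2)[of f "deriv (\<eta>k k)" k, OF f(1)] rescale)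
    qed
    also have "(LINT t|leb01. deriv (\<eta>k k) t * f (pulse_arg k t)) = A"
      using r
      by (simp add: A_def integral_pulse(1)[of f "deriv (\<eta>k k)" k, OF f(1)] rescale)
    finally show ?thesis using G(2) test_k[of k] by (simp add: has_weak_deriv_def)
  qed
  have int: "integrable leb01 (\<lambda>t. \<bar>\<eta>k k t\<bar> * norm (G t))" for k
    by (rule integrable_bounded_mult[OF G1, of _ M])
      (use test_function_L2(1)[OF test_k] M in \<open>auto simp: \<eta>k_def[abs_def] dest: L2_fun_measurable\<close>)
  have pulse_bound: "\<bar>A\<bar> * norm (w k) \<le> (LINT t|leb01. \<bar>\<eta>k k t\<bar> * norm (G t))" for k
  proof -
    have "\<bar>A\<bar> * norm (w k) = norm (LINT t|leb01. \<eta>k k t *\<^sub>R G t)"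
      using amplitude[of k] by (metis norm_minus_cancel norm_scaleR)
    also have "\<dots> \<le> (LINT t|leb01. norm (\<eta>k k t *\<^sub>R G t))" by (rule integral_norm_bound)
    finally show ?thesis by simp
  qed
  have "(\<Sum>k<n. \<bar>A\<bar> * norm (w k)) \<le> M * (LINT t|leb01. norm (G t))" for n
  proof -
    have "(\<Sum>k<n. \<bar>A\<bar> * norm (w k)) \<le> (\<Sum>k<n. LINT t|leb01. \<bar>\<eta>k k t\<bar> * norm (G t))"
      by (intro sum_mono pulse_bound)
    also have "\<dots> = (LINT t|leb01. (\<Sum>k<n. \<bar>\<eta>k k t\<bar> * norm (G t)))"
      by (rule Bochner_Integration.integral_sum[symmetric]) (rule int)
    also have "\<dots> \<le> (LINT t|leb01. M * norm (G t))"
    proof (rule integral_mono)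
      fix t
      obtain k where k: "only_pulse k t" using ex_only_pulse by blast
      have "(\<Sum>j<n. \<bar>\<eta>k j t\<bar>) = (\<Sum>j<n. if j = k then \<bar>\<eta>k k t\<bar> else 0)"
        using test_function_outside[OF \<eta>(1)] k by (intro sum.cong) (auto simp: \<eta>k_def only_pulse_def)
      also have "\<dots> \<le> \<bar>\<eta>k k t\<bar>" by simp
      also have "\<dots> \<le> M" using M by (simp add: \<eta>k_def)
      finally show "(\<Sum>k<n. \<bar>\<eta>k k t\<bar> * norm (G t)) \<le> M * norm (G t)"
        unfolding sum_distrib_right[symmetric] by (rule mult_right_mono) simp
    qed (use int G1 in auto)
    finally show ?thesis by simp
  qed
  then have "summable (\<lambda>k. \<bar>A\<bar> * norm (w k))"
    by (intro summableI_nonneg_bounded[of _ "M * (LINT t|leb01. norm (G t))"]) auto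
  then show ?thesis using \<eta>(2) by (simp add: A_def[symmetric] summable_cmult_iff)
qed

section \<open>The example\<close>

text \<open>The factor \<open>n\<^sup>-\<^sup>3\<close> of the series times the factor \<open>n (n + 1)\<close> of \<open>phi_scaled\<close>, with \<open>n = k + 1\<close>;
  it is of order \<open>1 / n\<close>.\<close>

definition amp :: "nat \<Rightarrow> real" where
  "amp k = real (Suc k) powi (-3) * rate k"

lemma amp_eq: "amp k = (real k + 2) / (real k + 1)\<^sup>2"
proof -
  have "amp k = (real k + 1) * (real k + 2) / (real k + 1) ^ 3"
    unfolding amp_def rate_eq power_int_def
    by (simp add: divide_inverse power_inverse add.commute mult.commute)
  also have "\<dots> = (real k + 2) / (real k + 1)\<^sup>2" by (simp add: power3_eq_cube power2_eq_square)
  finally show ?thesis .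
qed

lemma amp_lower: "1 / (real k + 1) \<le> amp k"
proof -
  have "1 / (real k + 1) = (real k + 1) / (real k + 1)\<^sup>2" by (simp add: power2_eq_square)
  also have "\<dots> \<le> amp k" unfolding amp_eq by (intro divide_right_mono) auto
  finally show ?thesis .
qed

lemma amp_upper: "amp k \<le> 2 / (real k + 1)"
proof -
  have "amp k \<le> ((real k + 1) * 2) / ((real k + 1) * (real k + 1))"
    unfolding amp_eq power2_eq_square by (intro divide_right_mono) auto
  also have "\<dots> = 2 / (real k + 1)" by (rule mult_divide_mult_cancel_left) simp
  finally show ?thesis .
qed

lemma amp_nonneg: "0 \<le> amp k"
  by (simp add: amp_eq)

text \<open>A representative that vanishes outside the unit interval, as required of a profile.\<close>

definition restrict01 :: "l2 \<Rightarrow> real \<Rightarrow> real" where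
  "restrict01 h t = indicator {0<..<1} t * rep_l2 h t"

lemma restrict01_L2: "restrict01 h \<in> L2_fun"
proof (rule L2_fun_dominated[OF _ rep_l2_in])
  show "restrict01 h \<in> borel_measurable leb01"
    using L2_fun_measurable[OF rep_l2_in[of h]]
    by (subst measurable_cong[of _ _ "rep_l2 h"]) (auto simp: restrict01_def)
qed (auto simp: restrict01_def indicator_def)

lemma profile_restrict01: "profile (restrict01 h)"
  by (simp add: profile_def L2_fun_integrable[OF restrict01_L2]) (simp add: restrict01_def)

lemma inner_restrict01:
  assumes "g \<in> L2_fun"
  shows "(LINT t|leb01. g t * restrict01 h t) = inner (abs_l2 g) h"
proof -
  have "(LINT t|leb01. g t * restrict01 h t) = (LINT t|leb01. g t * rep_l2 h t)"
    by (intro Bochner_Integration.integral_cong) (auto simp: restrict01_def)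
  then show ?thesis using inner_abs_l2[OF assms rep_l2_in, of h] by simp
qed

lemma rep_scaled: "f \<in> L2_fun \<Longrightarrow> AE x in leb01. rep_l2 (c *\<^sub>R abs_l2 f) x = c * f x"
  using rep_abs_l2[OF L2_fun_scale] by (simp add: abs_l2_scale[symmetric])

lemma example_u_single:
  assumes "\<forall>t. t \<notin> {0<..<1} \<longrightarrow> \<phi> t = 0" "only_pulse k t"
  shows "example_u \<phi> x t = \<phi> (pulse_arg k t) * amp k * psi (Suc k) x"
proof -
  have *: "real (Suc j) powi (-3) * phi_scaled \<phi> (Suc j) t * psi (Suc j) x =
      \<phi> (pulse_arg j t) * (amp j * psi (Suc j) x)" for j
    by (simp add: phi_scaled_def amp_def rate_def pulse_arg_def algebra_simps)
  have "example_u \<phi> x t = pulses \<phi> (\<lambda>j. amp j * psi (Suc j) x) t"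
    unfolding example_u_def pulses_def * by simp
  then show ?thesis by (simp add: pulses_single[OF assms])
qed

lemma h1_val_scale: "h1_val (c *\<^sub>R v) = c *\<^sub>R h1_val v"
  by (simp add: h1_val_def rep_h1_simps)

lemma H_to_Vdual_scale: "H_to_Vdual (c *\<^sub>R h) = c *\<^sub>R H_to_Vdual h"
  by (rule blinfun_eqI) (simp add: blinfun.scaleR_left)

lemma pulses_image:
  assumes "profile f" "\<And>c v. L (c *\<^sub>R v) = c *\<^sub>R L v"
  shows "L (pulses f y t) = pulses f (\<lambda>k. L (y k)) t"
proof -
  obtain k where k: "only_pulse k t" using ex_only_pulse by blast
  note single = profile_pulses[OF assms(1) k]
  have "L (pulses f y t) = L (f (pulse_arg k t) *\<^sub>R y k)" by (simp only: single)
  also have "\<dots> = f (pulse_arg k t) *\<^sub>R L (y k)" by (rule assms(2))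
  also have "\<dots> = pulses f (\<lambda>k. L (y k)) t" by (rule single[symmetric])
  finally show ?thesis .
qed

theorem theorem2p7:
  fixes \<phi> :: "real \<Rightarrow> real"
  assumes "\<exists>v\<in>h10. AE t in leb01. rep_l2 (h1_val v) t = \<phi> t"
    and "\<not> (AE t in leb01. \<phi> t = 0)"
    and "AE t in leb01. 0 \<le> \<phi> t"
    and "\<And>t. t \<notin> {0<..<1} \<Longrightarrow> \<phi> t = 0"
  shows "(\<exists>U\<in>W_space. represents (\<lambda>t. h1_val (U t)) (example_u \<phi>)) \<and>
    (\<exists>P\<in>bochner_Lp 2. represents P (\<lambda>x t. max (example_u \<phi> x t) 0) \<and>
      \<not> (\<exists>G\<in>bochner_Lp 1. has_weak_deriv (\<lambda>t. H_to_Vdual (P t)) G))"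
proof -
  have \<phi>0: "\<forall>t. t \<notin> {0<..<1} \<longrightarrow> \<phi> t = 0" using assms(4) by blast
  obtain v where v: "v \<in> h10" "AE t in leb01. rep_l2 (h1_val v) t = \<phi> t" using assms(1) by blast
  have mean: "inner (abs_l2 (\<lambda>_. 1)) (h1_val v) \<noteq> 0"
  proof
    assume "inner (abs_l2 (\<lambda>_. 1)) (h1_val v) = 0"
    then have "(LINT t|leb01. rep_l2 (h1_val v) t) = 0"
      using inner_abs_l2[OF L2_fun_const[of 1] rep_l2_in[of "h1_val v"]] by simp
    moreover have "AE t in leb01. 0 \<le> rep_l2 (h1_val v) t"
      using v(2) assms(3) by eventually_elim simp
    ultimately have "AE t in leb01. rep_l2 (h1_val v) t = 0"
      using integral_nonneg_eq_0_iff_AE[OF L2_fun_integrable[OF rep_l2_in[of "h1_val v"]]] by blast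
    with v(2) have "AE t in leb01. \<phi> t = 0" by eventually_elim simp
    with assms(2) show False by simp
  qed
  obtain \<rho> where \<rho>: "\<rho> \<in> test_functions" "(LINT x|leb01. \<rho> x) \<noteq> 0"
    using h10_nonzero_mean_test_function[OF v(1) mean] by blast
  obtain \<eta> where \<eta>: "\<eta> \<in> test_functions" "inner (abs_l2 (deriv \<eta>)) (h1_val v) \<noteq> 0"
    using h10_nonzero_mean_not_orthogonal[OF v(1) mean] by blast

  \<comment> \<open>\<open>\<phi>\<close> agrees with \<open>v\<close> only almost everywhere; \<open>f\<close> is a version of \<open>v\<close> vanishing outside the unit
    interval, and it has the same pulses as \<open>\<phi>\<close> at almost every time.\<close>
  define f where "f = restrict01 (h1_val v)"
  define f' where "f' = restrict01 (h1_grad v)"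
  have f: "profile f" "f \<in> L2_fun" and f': "profile f'" "f' \<in> L2_fun"
    by (simp_all add: f_def f'_def profile_restrict01 restrict01_L2)
  have "AE t in lebesgue. f t = \<phi> t \<and> 0 \<le> f t"
    using v(2) assms(3) unfolding AE_leb01_iff
    by eventually_elim (use assms(4) in \<open>auto simp: f_def restrict01_def indicator_def\<close>)
  then have "AE t in lebesgue. \<forall>k. f (pulse_arg k t) = \<phi> (pulse_arg k t) \<and> 0 \<le> f (pulse_arg k t)"
    by (rule AE_pulse_arg)
  then have f\<phi>: "AE t in leb01. \<forall>k. f (pulse_arg k t) = \<phi> (pulse_arg k t) \<and> 0 \<le> f (pulse_arg k t)"
    unfolding AE_leb01_iff by eventually_elim blast

  \<comment> \<open>The order \<open>k\<close> of the norm of the cosine in \<open>V\<close> is compensated by the amplitude of order \<open>1 / k\<close>.\<close>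
  define U where "U = pulses f (\<lambda>k. amp k *\<^sub>R psi_h1 (Suc k))"
  define w where "w k = amp k *\<^sub>R H_to_Vdual (abs_l2 (psi (Suc k)))" for k
  have "norm (amp k *\<^sub>R psi_h1 (Suc k)) \<le> 2 * (1 + pi)" for k
  proof -
    have "norm (amp k *\<^sub>R psi_h1 (Suc k)) \<le> (2 / (real k + 1)) * (1 + real (Suc k) * pi)"
      unfolding norm_scaleR abs_of_nonneg[OF amp_nonneg]
      by (rule mult_mono[OF amp_upper norm_psi_h1]) simp_all
    also have "\<dots> \<le> (2 / (real k + 1)) * ((real k + 1) * (1 + pi))"
      by (intro mult_left_mono) (auto simp: algebra_simps)
    finally show ?thesis by simp
  qed
  then have U_L2: "U \<in> bochner_Lp 2" unfolding U_def by (rule pulses_Lp2[OF f])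
  \<comment> \<open>The rate, of order \<open>k\<^sup>2\<close>, is compensated by the amplitude and by the dual norm of the cosine, each of
    order \<open>1 / k\<close>.\<close>
  have w: "norm (rate k *\<^sub>R w k) \<le> 4 / pi" for k
  proof -
    have "norm (rate k *\<^sub>R w k) \<le> rate k * ((2 / (real k + 1)) * (1 / (real (Suc k) * pi)))"
      unfolding w_def norm_scaleR using amp_nonneg[of k] amp_upper[of k] rate_pos[of k] norm_psi_dual[OF \<rho>, of k]
      by (intro mult_mono) auto
    also have "\<dots> = (2 * (real k + 2)) / ((real k + 1) * pi)"
    proof -
      have "(a * b) * ((2 / a) * (1 / (a * c))) = (2 * b) / (a * c)" if "a \<noteq> 0" for a b c :: real
        using that by simp
      from this[of "real k + 1" "real k + 2" pi] show ?thesis by (simp add: rate_eq add.commute)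
    qed
    also have "\<dots> \<le> ((real k + 1) * 4) / ((real k + 1) * pi)"
      by (intro divide_right_mono) auto
    also have "\<dots> = 4 / pi" by (rule mult_divide_mult_cancel_left) simp
    finally show ?thesis .
  qed
  have "has_weak_deriv (pulses f w) (pulses f' (\<lambda>k. rate k *\<^sub>R w k))"
  proof (rule has_weak_deriv_pulses[OF f f' _ w])
    fix \<zeta> assume \<zeta>: "smooth \<zeta>"
    then show "(LINT s|leb01. deriv \<zeta> s * f s) = - (LINT s|leb01. \<zeta> s * f' s)"
      using h10_by_parts[OF v(1) smooth_has_deriv[OF \<zeta>] smooth_continuous[OF smooth_deriv[OF \<zeta>]]]
      by (simp add: f_def f'_def inner_restrict01 L2_fun_continuous smooth_continuous smooth_deriv)
  qed
  moreover have "H_to_Vdual (h1_val (U t)) = pulses f w t" for t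
    unfolding U_def w_def pulses_image[OF f(1) h1_val_scale] pulses_image[OF f(1) H_to_Vdual_scale]
    by (simp add: h1_val_scale H_to_Vdual_scale psi_h1)
  ultimately have "U \<in> W_space"
    using U_L2 pulses_Lp2[OF f' w] by (auto simp: W_space_def)
  moreover have "represents (\<lambda>t. h1_val (U t)) (example_u \<phi>)"
    unfolding represents_def
    using f\<phi>
  proof eventually_elim
    case (elim t)
    obtain k where k: "only_pulse k t" using ex_only_pulse by blast
    have U: "h1_val (U t) = (\<phi> (pulse_arg k t) * amp k) *\<^sub>R abs_l2 (psi (Suc k))"
      unfolding U_def using elim
      by (simp add: profile_pulses[OF f(1) k] h1_val_scale psi_h1)
    have "psi (Suc k) \<in> L2_fun" by (rule L2_fun_continuous[OF psi_continuous(1)])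
    from rep_scaled[OF this, of "\<phi> (pulse_arg k t) * amp k"] show ?case
      by (simp add: U example_u_single[OF \<phi>0 k])
  qed
  moreover

  define P where "P = pulses f (\<lambda>k. amp k *\<^sub>R abs_l2 (\<lambda>x. max (psi (Suc k) x) 0))"
  have "norm (amp k *\<^sub>R abs_l2 (\<lambda>x. max (psi (Suc k) x) 0)) \<le> 2" for k
  proof -
    have "norm (abs_l2 (\<lambda>x. max (psi (Suc k) x) 0)) \<le> 1"
      by (intro norm_abs_l2_le L2_fun_measurable L2_fun_psi_pos) (simp add: psi_def)
    moreover have "amp k \<le> 2" using amp_upper[of k] by (rule order_trans) (simp add: divide_le_eq)
    ultimately have "amp k * norm (abs_l2 (\<lambda>x. max (psi (Suc k) x) 0)) \<le> 2 * 1"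
      using amp_nonneg[of k] by (intro mult_mono) auto
    then show ?thesis using amp_nonneg[of k] by simp
  qed
  then have "P \<in> bochner_Lp 2" unfolding P_def by (rule pulses_Lp2[OF f])
  moreover have "represents P (\<lambda>x t. max (example_u \<phi> x t) 0)"
    unfolding represents_def
    using f\<phi>
  proof eventually_elim
    case (elim t)
    obtain k where k: "only_pulse k t" using ex_only_pulse by blast
    let ?c = "\<phi> (pulse_arg k t) * amp k"
    have c: "0 \<le> ?c" using elim amp_nonneg[of k] by (metis mult_nonneg_nonneg)
    have P: "P t = ?c *\<^sub>R abs_l2 (\<lambda>x. max (psi (Suc k) x) 0)"
      unfolding P_def using elim
      by (simp add: profile_pulses[OF f(1) k])
    have "max (?c * b) 0 = ?c * max b 0" for b
      using c max_mult_distrib_left[of ?c b 0] by simp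
    with rep_scaled[OF L2_fun_psi_pos, of ?c "Suc k"] show ?case
      by (simp add: P example_u_single[OF \<phi>0 k])
  qed
  moreover have False if G: "G \<in> bochner_Lp 1" "has_weak_deriv (\<lambda>t. H_to_Vdual (P t)) G" for G
  proof -
    define z where "z k = amp k *\<^sub>R H_to_Vdual (abs_l2 (\<lambda>x. max (psi (Suc k) x) 0))" for k
    have "H_to_Vdual (P t) = pulses f z t" for t
      unfolding P_def z_def pulses_image[OF f(1) H_to_Vdual_scale] by (simp add: H_to_Vdual_scale)
    then have "has_weak_deriv (pulses f z) G" using G(2) by simp
    moreover have "(LINT s|leb01. deriv \<eta> s * f s) \<noteq> 0"
      using \<eta> by (simp add: f_def inner_restrict01 test_function_L2)
    ultimately have "summable (\<lambda>k. norm (z k))"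
      by (intro summable_amplitudes[OF f \<eta>(1) _ G(1)])
    then have "summable (\<lambda>k. 4 * norm (z k))" by (rule summable_mult)
    then have "summable (\<lambda>k. inverse (real (Suc k)))"
    proof (rule summable_comparison_test')
      fix k
      have "1 / (real k + 1) * (1 / 4) \<le> amp k * norm (H_to_Vdual (abs_l2 (\<lambda>x. max (psi (Suc k) x) 0)))"
        using amp_lower[of k] amp_nonneg[of k] norm_psi_pos_dual[of k] by (intro mult_mono) auto
      also have "\<dots> = norm (z k)" using amp_nonneg[of k] by (simp add: z_def)
      finally have "1 / (real k + 1) * (1 / 4) \<le> norm (z k)" .
      moreover have "a \<le> 4 * b" if "a * (1 / 4) \<le> b" for a b :: real using that by simp
      ultimately have "1 / (real k + 1) \<le> 4 * norm (z k)" by blast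
      then show "norm (inverse (real (Suc k))) \<le> 4 * norm (z k)"
        by (simp add: inverse_eq_divide add.commute)
    qed
    then show False
      using not_summable_harmonic[where 'a = real] summable_Suc_iff[of "\<lambda>n. inverse (real n)"] by blast
  qed
  ultimately show ?thesis by blast
qed

end
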